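(* Let $T$ and $S$ belong to $\mathcal{G}$, and suppose that for all choices of subsets $D_n\subset B_n$ ($n\in\mathbb{N}$) with $\#(D_n)=o(n)$ one has $$\lim_{n\to\infty}\frac1n\sum_{e_{lk}\in D_n}\|T(e_{lk})\|^2=\lim_{n\to\infty}\frac1n\sum_{e_{lk}\in D_n}\|S(e_{lk})\|^2=0.$$ Then $$\langle T,S\rangle_{\mathcal{G}}=\lim_{n\to\infty}\frac1n\sum_{e_{lk}\in B_n}\langle T(e_{lk}),S(e_{lk})\rangle.$$
   Context: Let $I=(0,1]\cap\mathbb{Q}$. The space $L^2[-\pi,\pi]$ carries the inner product $\langle g,h\rangle=\frac1{2\pi}\int_{-\pi}^{\pi}g\overline{h}\,dt$, and $H^2[-\pi,\pi]$ is its closed subspace of functions whose Fourier coefficients of negative index vanish. Let $\mathcal{L}^2=\bigoplus_{l\in I}L^2[-\pi,\pi]$ and $\mathcal{H}^2=\bigoplus_{l\in I}H^2[-\pi,\pi]$ be the Hilbert-space direct sums (square-summable families indexed by $I$), and let $P$ be the orthogonal projection of $\mathcal{L}^2$ onto $\mathcal{H}^2$. For $l\in I$, $k\in\mathbb{Z}$, $e_{lk}\in\mathcal{L}^2$ is the family whose $l$-th component is $e^{ikt}$ and whose other components are $0$; $\mathcal{B}_{\mathcal H}=\{e_{lk}:l\in I,k\ge0\}$ is an orthonormal basis of $\mathcal{H}^2$. $L(\mathcal{H}^2)$ is the space of all linear operators $T:D(T)\to\mathcal{H}^2$, $D(T)$ a linear subspace of $\mathcal{H}^2$, whose domain contains $\mathcal{B}_{\mathcal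 H}$. For $j,k\in\mathbb{Z}$, $T_{jk}$ is the operator on $\mathcal{H}^2$ given by $T_{jk}((f_l))=P\big((e^{2\pi ijl}e^{ikt}f_l)\big)$. $E$ is the linear span of $\{T_{jk}:j,k\in\mathbb{Z}\}$. For $s\in\mathbb{N}$, $I_s=\{j/s:j=1,\dots,s\}$, and $B_n=\{e_{lk}:k=0,1,\dots,\lfloor n/\sqrt n\rfloor-1,\ l\in I_{\lfloor\sqrt n\rfloor}\}$. For $T\in L(\mathcal{H}^2)$, $$Q(T)=\inf\left\{\limsup_{n\to\infty}\frac1{\sqrt n}\Big(\sum_{e_{lk}\in C_n}\|T(e_{lk})\|^2\Big)^{1/2}:\ C_n\sqcup D_n=B_n,\ \lim_{n\to\infty}\frac1n\#(D_n)=0\right\}.$$ Let $L_g=\{T\in L(\mathcal{H}^2):Q(T)<\infty\}$, $Z(\mathcal{H}^2)=\{Z\in L(\mathcal{H}^2):Q(Z)=0\}$, $L_G=L_g/Z(\mathcal{H}^2)$ with norm $\tilde Q(T+Z(\mathcal{H}^2))=Q(T)$. $\mathcal{G}$ is the closure of (the image of) $E$ in $L_G$ with respect to $\tilde Q$, with inner product $\langle\cdot,\cdot\rangle_{\mathcal{G}}$ obtained from $\tilde Q$ by the polarization identity. Saying that an operator $T\in L(\mathcal{H}^2)$ belongs to $\mathcal{G}$ means that its class does; the hypotheses and the right-hand side of the formula refer to the given operators $T,S$ themselves. *)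

theory Defs
  imports "HOL-Analysis.Analysis" "HOL-Library.Landau_Symbols"
begin

section \<open>Complex inner product spaces\<close>

text \<open>The norm, metric and topology are those of the underlying real inner product
  \<open>Re \<langle>x, y\<rangle>\<close>. The inner product is linear in its first argument.\<close>

class complex_inner = real_inner +
  fixes scaleC :: "complex \<Rightarrow> 'a \<Rightarrow> 'a" (infixr \<open>*\<^sub>C\<close> 75)
    and cinner :: "'a \<Rightarrow> 'a \<Rightarrow> complex"
  assumes scaleC_add_right: "a *\<^sub>C (x + y) = a *\<^sub>C x + a *\<^sub>C y"
    and scaleC_add_left: "(a + b) *\<^sub>C x = a *\<^sub>C x + b *\<^sub>C x"
    and scaleC_scaleC: "a *\<^sub>C b *\<^sub>C x = (a * b) *\<^sub>C x"
    and scaleC_one: "1 *\<^sub>C x = x"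
    and scaleR_scaleC: "r *\<^sub>R x = complex_of_real r *\<^sub>C x"
    and cinner_add_left: "cinner (x + y) z = cinner x z + cinner y z"
    and cinner_scaleC_left: "cinner (a *\<^sub>C x) y = a * cinner x y"
    and cinner_commute: "cinner x y = cnj (cinner y x)"
    and inner_cinner: "inner x y = Re (cinner x y)"

interpretation complex_vector: vector_space "scaleC :: complex \<Rightarrow> 'a \<Rightarrow> 'a::complex_inner"
  by unfold_locales (simp_all add: scaleC_add_right scaleC_add_left scaleC_scaleC scaleC_one)

lemma cinner_scaleC_right:
  fixes x y :: "'a::complex_inner"
  shows "cinner x (a *\<^sub>C y) = cnj a * cinner x y"
  by (metis cinner_commute cinner_scaleC_left complex_cnj_mult)

lemma cinner_self:
  fixes x :: "'a::complex_inner"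
  shows "cinner x x = complex_of_real ((norm x)\<^sup>2)"
proof -
  have "Im (cinner x x) = 0"
    by (metis cinner_commute complex_cnj_cancel_iff Reals_cnj_iff complex_is_Real_iff)
  moreover have "Re (cinner x x) = (norm x)\<^sup>2"
    by (simp add: inner_cinner[symmetric] power2_norm_eq_inner)
  ultimately show ?thesis by (simp add: complex_eq_iff)
qed

lemma norm_scaleC:
  fixes x :: "'a::complex_inner"
  shows "norm (a *\<^sub>C x) = cmod a * norm x"
proof -
  have "complex_of_real ((norm (a *\<^sub>C x))\<^sup>2) = complex_of_real ((cmod a * norm x)\<^sup>2)"
    by (simp only: cinner_self[symmetric] cinner_scaleC_left cinner_scaleC_right power_mult_distrib
        of_real_mult complex_norm_square mult.assoc mult.left_commute)
  hence "(norm (a *\<^sub>C x))\<^sup>2 = (cmod a * norm x)\<^sup>2"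
    by (simp only: of_real_eq_iff)
  thus ?thesis by (simp add: power2_eq_iff_nonneg)
qed

lemma complex_Cauchy_Schwarz:
  fixes x y :: "'a::complex_inner"
  shows "cmod (cinner x y) \<le> norm x * norm y"
proof (cases "cinner x y = 0")
  case False
  define u where "u = cnj (cinner x y) / cmod (cinner x y)"
  have u: "cmod u = 1" using False by (simp add: u_def norm_divide)
  have "u * cinner x y = cmod (cinner x y)"
    using False by (simp add: u_def complex_norm_square[symmetric] mult.commute[of "cnj _"] power2_eq_square)
  hence "cmod (cinner x y) = Re (cinner (u *\<^sub>C x) y)"
    by (simp add: cinner_scaleC_left)
  also have "\<dots> \<le> norm (u *\<^sub>C x) * norm y"
    by (simp add: inner_cinner[symmetric] norm_cauchy_schwarz)
  finally show ?thesis by (simp add: norm_scaleC u)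
qed simp

text \<open>Meaningful when the projection exists, as for closed subspaces of a Hilbert space.\<close>

definition orth_proj :: "'a::complex_inner set \<Rightarrow> 'a \<Rightarrow> 'a" where
  "orth_proj S x = (THE y. y \<in> S \<and> (\<forall>z\<in>S. cinner (x - y) z = 0))"


section \<open>The space \<open>L\<^sup>2[-\<pi>,\<pi>]\<close>\<close>

definition sq_integrable :: "(real \<Rightarrow> complex) \<Rightarrow> bool" where
  "sq_integrable f \<longleftrightarrow> f \<in> borel_measurable (lebesgue_on {-pi..pi}) \<and>
     integrable (lebesgue_on {-pi..pi}) (\<lambda>t. (cmod (f t))\<^sup>2)"

definition L2_rel :: "(real \<Rightarrow> complex) \<Rightarrow> (real \<Rightarrow> complex) \<Rightarrow> bool" where
  "L2_rel f g \<longleftrightarrow> sq_integrable f \<and> sq_integrable g \<and> (AE t in lebesgue_on {-pi..pi}. f t = g t)"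

lemma sq_integrable_zero: "sq_integrable (\<lambda>_. 0)"
  by (simp add: sq_integrable_def)

lemma sq_integrable_mult:
  assumes "sq_integrable f" "sq_integrable g"
  shows "integrable (lebesgue_on {-pi..pi}) (\<lambda>t. f t * cnj (g t))"
proof (rule Bochner_Integration.integrable_bound)
  show "integrable (lebesgue_on {-pi..pi}) (\<lambda>t. (cmod (f t))\<^sup>2 + (cmod (g t))\<^sup>2)"
    using assms by (auto simp: sq_integrable_def)
  have [measurable]: "f \<in> borel_measurable (lebesgue_on {-pi..pi})"
    "g \<in> borel_measurable (lebesgue_on {-pi..pi})"
    using assms by (auto simp: sq_integrable_def)
  have [measurable]: "cnj \<in> borel_measurable borel"
    by (intro borel_measurable_continuous_onI continuous_intros)
  show "(\<lambda>t. f t * cnj (g t)) \<in> borel_measurable (lebesgue_on {-pi..pi})"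
    by measurable
  have "x * y \<le> x\<^sup>2 + y\<^sup>2" if "0 \<le> x" "0 \<le> y" for x y :: real
    using that sum_squares_bound[of x y] mult_nonneg_nonneg[OF that] by linarith
  thus "AE t in lebesgue_on {-pi..pi}.
      norm (f t * cnj (g t)) \<le> norm ((cmod (f t))\<^sup>2 + (cmod (g t))\<^sup>2)"
    by (auto simp: norm_mult)
qed

lemma sq_integrable_add:
  assumes "sq_integrable f" "sq_integrable g"
  shows "sq_integrable (\<lambda>t. f t + g t)"
proof -
  have [measurable]: "f \<in> borel_measurable (lebesgue_on {-pi..pi})"
    "g \<in> borel_measurable (lebesgue_on {-pi..pi})"
    using assms by (auto simp: sq_integrable_def)
  have "integrable (lebesgue_on {-pi..pi}) (\<lambda>t. (cmod (f t + g t))\<^sup>2)"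
  proof (rule Bochner_Integration.integrable_bound)
    show "integrable (lebesgue_on {-pi..pi}) (\<lambda>t. 2 * (cmod (f t))\<^sup>2 + 2 * (cmod (g t))\<^sup>2)"
      using assms by (auto simp: sq_integrable_def)
    show "(\<lambda>t. (cmod (f t + g t))\<^sup>2) \<in> borel_measurable (lebesgue_on {-pi..pi})"
      by measurable
    have "(cmod (x + y))\<^sup>2 \<le> 2 * (cmod x)\<^sup>2 + 2 * (cmod y)\<^sup>2" for x y
    proof -
      have "(cmod (x + y))\<^sup>2 \<le> (cmod x + cmod y)\<^sup>2"
        by (intro power_mono norm_triangle_ineq) auto
      also have "\<dots> \<le> 2 * (cmod x)\<^sup>2 + 2 * (cmod y)\<^sup>2"
        using sum_squares_bound[of "cmod x" "cmod y"] by (simp add: power2_sum)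
      finally show ?thesis .
    qed
    thus "AE t in lebesgue_on {-pi..pi}.
        norm ((cmod (f t + g t))\<^sup>2) \<le> norm (2 * (cmod (f t))\<^sup>2 + 2 * (cmod (g t))\<^sup>2)"
      by auto
  qed
  thus ?thesis by (simp add: sq_integrable_def)
qed

lemma sq_integrable_bounded_mult:
  assumes "sq_integrable f" "h \<in> borel_measurable (lebesgue_on {-pi..pi})" "\<And>t. cmod (h t) \<le> c"
  shows "sq_integrable (\<lambda>t. h t * f t)"
proof -
  have [measurable]: "f \<in> borel_measurable (lebesgue_on {-pi..pi})"
    "h \<in> borel_measurable (lebesgue_on {-pi..pi})"
    using assms by (auto simp: sq_integrable_def)
  have "integrable (lebesgue_on {-pi..pi}) (\<lambda>t. (cmod (h t * f t))\<^sup>2)"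
  proof (rule Bochner_Integration.integrable_bound)
    show "integrable (lebesgue_on {-pi..pi}) (\<lambda>t. c\<^sup>2 * (cmod (f t))\<^sup>2)"
      using assms by (auto simp: sq_integrable_def)
    show "(\<lambda>t. (cmod (h t * f t))\<^sup>2) \<in> borel_measurable (lebesgue_on {-pi..pi})"
      by measurable
    show "AE t in lebesgue_on {-pi..pi}. norm ((cmod (h t * f t))\<^sup>2) \<le> norm (c\<^sup>2 * (cmod (f t))\<^sup>2)"
      by (auto simp: norm_mult power_mult_distrib intro!: mult_right_mono power_mono assms(3))
  qed
  thus ?thesis by (simp add: sq_integrable_def)
qed

lemma sq_integrable_scale: "sq_integrable f \<Longrightarrow> sq_integrable (\<lambda>t. a * f t)"
  by (rule sq_integrable_bounded_mult[where c = "cmod a"]) auto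

lemma exp_measurable:
  "(\<lambda>t::real. exp (\<i> * of_int k * of_real t)) \<in> borel_measurable (lebesgue_on {-pi..pi})"
  by (intro continuous_imp_measurable_on_sets_lebesgue continuous_intros) auto

lemma cmod_exp_ikt: "cmod (exp (\<i> * of_int k * complex_of_real t)) = 1"
  by simp

lemma sq_integrable_exp_mult:
  "sq_integrable f \<Longrightarrow> sq_integrable (\<lambda>t. exp (\<i> * of_int k * of_real t) * f t)"
  by (rule sq_integrable_bounded_mult[where c = 1]) (auto intro: exp_measurable)

lemma sq_integrable_const: "sq_integrable (\<lambda>_. a)"
  by (simp add: sq_integrable_def finite_measure.integrable_const finite_measure_lebesgue_on)

lemma sq_integrable_exp: "sq_integrable (\<lambda>t. exp (\<i> * of_int k * of_real t))"
  using sq_integrable_exp_mult[OF sq_integrable_const[of 1], of k] by simp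

quotient_type L2 = "real \<Rightarrow> complex" / partial: L2_rel
proof (rule part_equivpI)
  show "\<exists>f. L2_rel f f"
    using sq_integrable_zero by (auto simp: L2_rel_def)
  show "symp L2_rel"
    by (auto simp: symp_def L2_rel_def elim: AE_mp)
  show "transp L2_rel"
    unfolding transp_def L2_rel_def
    by (auto elim: AE_mp)
qed

instantiation L2 :: complex_inner
begin

lift_definition zero_L2 :: L2 is "\<lambda>_. 0"
  by (simp add: L2_rel_def sq_integrable_zero)

lift_definition plus_L2 :: "L2 \<Rightarrow> L2 \<Rightarrow> L2" is "\<lambda>f g t. f t + g t"
  by (auto simp: L2_rel_def intro: sq_integrable_add elim: AE_mp)

lift_definition scaleC_L2 :: "complex \<Rightarrow> L2 \<Rightarrow> L2" is "\<lambda>a f t. a * f t"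
  by (auto simp: L2_rel_def intro: sq_integrable_scale elim: AE_mp)

lift_definition cinner_L2 :: "L2 \<Rightarrow> L2 \<Rightarrow> complex" is
  "\<lambda>f g. 1 / (2 * pi) * (LINT t|lebesgue_on {-pi..pi}. f t * cnj (g t))"
proof -
  fix f f' g g' assume 1: "L2_rel f f'" and 2: "L2_rel g g'"
  have "(LINT t|lebesgue_on {-pi..pi}. f t * cnj (g t)) = (LINT t|lebesgue_on {-pi..pi}. f' t * cnj (g' t))"
  proof (rule integral_cong_AE)
    show "(\<lambda>t. f t * cnj (g t)) \<in> borel_measurable (lebesgue_on {-pi..pi})"
      "(\<lambda>t. f' t * cnj (g' t)) \<in> borel_measurable (lebesgue_on {-pi..pi})"
      using 1 2 by (auto simp: L2_rel_def intro!: borel_measurable_integrable sq_integrable_mult)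
    have "AE t in lebesgue_on {-pi..pi}. f t = f' t" "AE t in lebesgue_on {-pi..pi}. g t = g' t"
      using 1 2 by (auto simp: L2_rel_def)
    thus "AE t in lebesgue_on {-pi..pi}. f t * cnj (g t) = f' t * cnj (g' t)"
      by eventually_elim simp
  qed
  thus "complex_of_real (1 / (2 * pi)) * (LINT t|lebesgue_on {-pi..pi}. f t * cnj (g t)) =
      complex_of_real (1 / (2 * pi)) * (LINT t|lebesgue_on {-pi..pi}. f' t * cnj (g' t))"
    by simp
qed

definition uminus_L2 :: "L2 \<Rightarrow> L2" where "- x = (-1) *\<^sub>C x" for x :: L2
definition minus_L2 :: "L2 \<Rightarrow> L2 \<Rightarrow> L2" where "x - y = x + - y" for x y :: L2
definition scaleR_L2 :: "real \<Rightarrow> L2 \<Rightarrow> L2" where "r *\<^sub>R x = complex_of_real r *\<^sub>C x" for x :: L2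
definition inner_L2 :: "L2 \<Rightarrow> L2 \<Rightarrow> real" where "inner x y = Re (cinner x y)" for x y :: L2
definition norm_L2 :: "L2 \<Rightarrow> real" where "norm x = sqrt (inner x x)" for x :: L2
definition sgn_L2 :: "L2 \<Rightarrow> L2" where "sgn x = inverse (norm x) *\<^sub>R x" for x :: L2
definition dist_L2 :: "L2 \<Rightarrow> L2 \<Rightarrow> real" where "dist x y = norm (x - y)" for x y :: L2
definition uniformity_L2 :: "(L2 \<times> L2) filter" where
  "uniformity_L2 = (INF e\<in>{0<..}. principal {(x, y). dist x y < e})"
definition open_L2 :: "L2 set \<Rightarrow> bool" where
  "open_L2 U \<longleftrightarrow> (\<forall>x\<in>U. \<forall>\<^sub>F (x', y) in uniformity. x' = x \<longrightarrow> y \<in> U)"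

instance
proof
  fix x y z :: L2 and a b :: complex and r s :: real and U :: "L2 set"
  show add_assoc: "x + y + z = x + (y + z)"
    by transfer (auto simp: L2_rel_def add.assoc intro!: sq_integrable_add)
  show add_comm: "x + y = y + x"
    by transfer (auto simp: L2_rel_def add.commute intro!: sq_integrable_add)
  show "0 + x = x"
    by transfer (auto simp: L2_rel_def)
  show "- x + x = 0"
    unfolding uminus_L2_def
    by transfer (auto simp: L2_rel_def intro!: sq_integrable_zero)
  show "x - y = x + - y" by (simp add: minus_L2_def)
  have 1: "a *\<^sub>C (x + y) = a *\<^sub>C x + a *\<^sub>C y" for a and x y :: L2
    by transfer (auto simp: L2_rel_def algebra_simps intro!: sq_integrable_add sq_integrable_scale)
  have 2: "(a + b) *\<^sub>C x = a *\<^sub>C x + b *\<^sub>C x" for a b and x :: L2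
    by transfer (auto simp: L2_rel_def distrib_right intro!: sq_integrable_add sq_integrable_scale)
  have 3: "a *\<^sub>C b *\<^sub>C x = (a * b) *\<^sub>C x" for a b and x :: L2
    by transfer (auto simp: L2_rel_def mult.assoc intro!: sq_integrable_scale)
  have 4: "1 *\<^sub>C x = x" for x :: L2
    by transfer (auto simp: L2_rel_def)
  have 5: "r *\<^sub>R x = complex_of_real r *\<^sub>C x" for r and x :: L2
    by (rule scaleR_L2_def)
  show "r *\<^sub>R (x + y) = r *\<^sub>R x + r *\<^sub>R y" by (simp add: 5 1)
  show "(r + s) *\<^sub>R x = r *\<^sub>R x + s *\<^sub>R x" by (simp add: 5 2)
  show "r *\<^sub>R s *\<^sub>R x = (r * s) *\<^sub>R x" by (simp add: 5 3)
  show "1 *\<^sub>R x = x" by (simp add: 5 4)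
  have 6: "cinner (x + y) z = cinner x z + cinner y z" for x y z :: L2
    by transfer (auto simp: L2_rel_def distrib_right distrib_left add_divide_distrib Bochner_Integration.integral_add sq_integrable_mult)
  have 7: "cinner (a *\<^sub>C x) y = a * cinner x y" for a and x y :: L2
    by transfer (auto simp: L2_rel_def mult.assoc)
  have 8: "cinner x y = cnj (cinner y x)" for x y :: L2
  proof transfer
    fix f g assume "L2_rel f f" "L2_rel g g"
    have "(LINT t|lebesgue_on {-pi..pi}. f t * cnj (g t)) = (LINT t|lebesgue_on {-pi..pi}. cnj (g t * cnj (f t)))"
      by (simp add: mult.commute)
    also have "\<dots> = cnj (LINT t|lebesgue_on {-pi..pi}. g t * cnj (f t))"
      by (rule Bochner_Integration.integral_cnj)
    finally show "complex_of_real (1 / (2 * pi)) * (LINT t|lebesgue_on {-pi..pi}. f t * cnj (g t)) =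
        cnj (complex_of_real (1 / (2 * pi)) * (LINT t|lebesgue_on {-pi..pi}. g t * cnj (f t)))"
      by simp
  qed
  have 9: "inner x y = Re (cinner x y)" for x y :: L2
    by (rule inner_L2_def)
  show "inner x y = inner y x" by (subst (1 2) 9, subst 8) simp
  show "inner (x + y) z = inner x z + inner y z" by (simp add: 9 6)
  show "inner (r *\<^sub>R x) y = r * inner x y" by (simp add: 9 5 7)
  have sq: "1 / (2 * pi) * (LINT t|lebesgue_on {-pi..pi}. f t * cnj (f t)) =
      complex_of_real (1 / (2 * pi) * (LINT t|lebesgue_on {-pi..pi}. (cmod (f t))\<^sup>2))" for f
    by (simp add: complex_norm_square[symmetric] flip: of_real_power)
  show "0 \<le> inner x x"
    unfolding 9 by transfer (unfold sq, simp)
  show "inner x x = 0 \<longleftrightarrow> x = 0"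
    unfolding 9
  proof transfer
    fix f assume "L2_rel f f"
    hence f: "sq_integrable f" by (simp add: L2_rel_def)
    have "(LINT t|lebesgue_on {-pi..pi}. (cmod (f t))\<^sup>2) = 0 \<longleftrightarrow>
        (AE t in lebesgue_on {-pi..pi}. (cmod (f t))\<^sup>2 = 0)"
      by (rule integral_nonneg_eq_0_iff_AE) (use f in \<open>auto simp: sq_integrable_def\<close>)
    thus "Re (complex_of_real (1 / (2 * pi)) * (LINT t|lebesgue_on {-pi..pi}. f t * cnj (f t))) = 0
        \<longleftrightarrow> L2_rel f (\<lambda>_. 0)"
      unfolding sq using f by (simp add: L2_rel_def sq_integrable_zero)
  qed
  show "norm x = sqrt (inner x x)" by (rule norm_L2_def)
  show "sgn x = inverse (norm x) *\<^sub>R x" by (rule sgn_L2_def)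
  show "dist x y = norm (x - y)" by (rule dist_L2_def)
  show "uniformity = (INF e\<in>{0<..}. principal {(x::L2, y). dist x y < e})"
    by (rule uniformity_L2_def)
  show "open U \<longleftrightarrow> (\<forall>x\<in>U. \<forall>\<^sub>F (x', y) in uniformity. x' = x \<longrightarrow> y \<in> U)"
    by (rule open_L2_def)
  show "a *\<^sub>C (x + y) = a *\<^sub>C x + a *\<^sub>C y" by (rule 1)
  show "(a + b) *\<^sub>C x = a *\<^sub>C x + b *\<^sub>C x" by (rule 2)
  show "a *\<^sub>C b *\<^sub>C x = (a * b) *\<^sub>C x" by (rule 3)
  show "1 *\<^sub>C x = x" by (rule 4)
  show "r *\<^sub>R x = complex_of_real r *\<^sub>C x" by (rule 5)
  show "cinner (x + y) z = cinner x z + cinner y z" by (rule 6)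
  show "cinner (a *\<^sub>C x) y = a * cinner x y" by (rule 7)
  show "cinner x y = cnj (cinner y x)" by (rule 8)
  show "inner x y = Re (cinner x y)" by (rule 9)
qed

end

text \<open>\<open>trig k\<close> is the function \<open>e\<^sup>i\<^sup>k\<^sup>t\<close>; \<open>modulate k\<close> is multiplication by it.\<close>

lift_definition trig :: "int \<Rightarrow> L2" is "\<lambda>k t. exp (\<i> * of_int k * of_real t)"
  by (simp add: L2_rel_def sq_integrable_exp)

lift_definition modulate :: "int \<Rightarrow> L2 \<Rightarrow> L2" is "\<lambda>k f t. exp (\<i> * of_int k * of_real t) * f t"
  by (auto simp: L2_rel_def intro: sq_integrable_exp_mult elim: AE_mp)

definition H2 :: "L2 set" where
  "H2 = {f. \<forall>k<0. cinner f (trig k) = 0}"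

lemma norm_modulate: "norm (modulate k f) = norm f"
proof -
  have "cinner (modulate k f) (modulate k f) = cinner f f"
  proof transfer
    fix k f
    have ee: "exp (\<i> * of_int k * of_real t) * cnj (exp (\<i> * of_int k * complex_of_real t)) = 1" for t
      by (metis cmod_exp_ikt complex_norm_square of_real_1 power_one)
    have "exp (\<i> * of_int k * of_real t) * f t * cnj (exp (\<i> * of_int k * of_real t) * f t) = f t * cnj (f t)"
      for t :: real
      by (metis (no_types, opaque_lifting) complex_cnj_mult ee mult.assoc mult.commute mult_1)
    thus "complex_of_real (1 / (2 * pi)) * (LINT t|lebesgue_on {-pi..pi}.
          exp (\<i> * of_int k * of_real t) * f t * cnj (exp (\<i> * of_int k * of_real t) * f t)) =
        complex_of_real (1 / (2 * pi)) * (LINT t|lebesgue_on {-pi..pi}. f t * cnj (f t))"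
      by (simp only:)
  qed
  thus ?thesis by (simp add: norm_eq_sqrt_inner inner_cinner)
qed


section \<open>The Hilbert space direct sum over \<open>(0,1] \<inter> \<rat>\<close>\<close>

definition I_rat :: "real set" where
  "I_rat = {0<..1} \<inter> \<rat>"

text \<open>A family indexed by \<open>I_rat\<close> is a function on the reals that vanishes outside \<open>I_rat\<close>.\<close>

typedef LL2 = "{f :: real \<Rightarrow> L2. (\<forall>l. l \<notin> I_rat \<longrightarrow> f l = 0) \<and> (\<lambda>l. (norm (f l))\<^sup>2) summable_on I_rat}"
  morphisms component Abs_LL2
  by (rule exI[of _ "\<lambda>_. 0"]) simp

setup_lifting type_definition_LL2

lemma summable_norm_sq_add:
  fixes f g :: "real \<Rightarrow> 'a::real_normed_vector"
  assumes "(\<lambda>l. (norm (f l))\<^sup>2) summable_on A" "(\<lambda>l. (norm (g l))\<^sup>2) summable_on A"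
  shows "(\<lambda>l. (norm (f l + g l))\<^sup>2) summable_on A"
proof (rule summable_on_comparison_test)
  show "(\<lambda>l. 2 * (norm (f l))\<^sup>2 + 2 * (norm (g l))\<^sup>2) summable_on A"
    using assms by (intro summable_on_add summable_on_cmult_right)
  fix l
  have "(norm (f l + g l))\<^sup>2 \<le> (norm (f l) + norm (g l))\<^sup>2"
    by (intro power_mono norm_triangle_ineq) auto
  also have "\<dots> \<le> 2 * (norm (f l))\<^sup>2 + 2 * (norm (g l))\<^sup>2"
    using sum_squares_bound[of "norm (f l)" "norm (g l)"] by (simp add: power2_sum)
  finally show "(norm (f l + g l))\<^sup>2 \<le> 2 * (norm (f l))\<^sup>2 + 2 * (norm (g l))\<^sup>2" .
qed auto

lemma summable_norm_sq_scaleC: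
  fixes f :: "real \<Rightarrow> 'a::complex_inner"
  assumes "(\<lambda>l. (norm (f l))\<^sup>2) summable_on A"
  shows "(\<lambda>l. (norm (a *\<^sub>C f l))\<^sup>2) summable_on A"
  using summable_on_cmult_right[OF assms, of "(cmod a)\<^sup>2"]
  by (simp add: norm_scaleC power_mult_distrib)

lemma summable_cinner:
  fixes f g :: "real \<Rightarrow> 'a::complex_inner"
  assumes "(\<lambda>l. (norm (f l))\<^sup>2) summable_on A" "(\<lambda>l. (norm (g l))\<^sup>2) summable_on A"
  shows "(\<lambda>l. cinner (f l) (g l)) summable_on A"
proof (rule abs_summable_summable, rule summable_on_comparison_test)
  show "(\<lambda>l. (norm (f l))\<^sup>2 + (norm (g l))\<^sup>2) summable_on A"
    using assms by (rule summable_on_add)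
  fix l
  have "0 \<le> norm (f l) * norm (g l)" by simp
  thus "norm (cinner (f l) (g l)) \<le> (norm (f l))\<^sup>2 + (norm (g l))\<^sup>2"
    using complex_Cauchy_Schwarz[of "f l" "g l"] sum_squares_bound[of "norm (f l)" "norm (g l)"]
    by linarith
qed auto

instantiation LL2 :: complex_inner
begin

lift_definition zero_LL2 :: LL2 is "\<lambda>_. 0"
  by simp

lift_definition plus_LL2 :: "LL2 \<Rightarrow> LL2 \<Rightarrow> LL2" is "\<lambda>f g l. f l + g l"
  by (auto intro: summable_norm_sq_add)

lift_definition scaleC_LL2 :: "complex \<Rightarrow> LL2 \<Rightarrow> LL2" is "\<lambda>a f l. a *\<^sub>C f l"
  by (auto intro: summable_norm_sq_scaleC)

lift_definition cinner_LL2 :: "LL2 \<Rightarrow> LL2 \<Rightarrow> complex" is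
  "\<lambda>f g. \<Sum>\<^sub>\<infinity>l\<in>I_rat. cinner (f l) (g l)" .

definition uminus_LL2 :: "LL2 \<Rightarrow> LL2" where "- x = (-1) *\<^sub>C x" for x :: LL2
definition minus_LL2 :: "LL2 \<Rightarrow> LL2 \<Rightarrow> LL2" where "x - y = x + - y" for x y :: LL2
definition scaleR_LL2 :: "real \<Rightarrow> LL2 \<Rightarrow> LL2" where "r *\<^sub>R x = complex_of_real r *\<^sub>C x" for x :: LL2
definition inner_LL2 :: "LL2 \<Rightarrow> LL2 \<Rightarrow> real" where "inner x y = Re (cinner x y)" for x y :: LL2
definition norm_LL2 :: "LL2 \<Rightarrow> real" where "norm x = sqrt (inner x x)" for x :: LL2
definition sgn_LL2 :: "LL2 \<Rightarrow> LL2" where "sgn x = inverse (norm x) *\<^sub>R x" for x :: LL2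
definition dist_LL2 :: "LL2 \<Rightarrow> LL2 \<Rightarrow> real" where "dist x y = norm (x - y)" for x y :: LL2
definition uniformity_LL2 :: "(LL2 \<times> LL2) filter" where
  "uniformity_LL2 = (INF e\<in>{0<..}. principal {(x, y). dist x y < e})"
definition open_LL2 :: "LL2 set \<Rightarrow> bool" where
  "open_LL2 U \<longleftrightarrow> (\<forall>x\<in>U. \<forall>\<^sub>F (x', y) in uniformity. x' = x \<longrightarrow> y \<in> U)"

instance
proof
  fix x y z :: LL2 and a b :: complex and r s :: real and U :: "LL2 set"
  show "x + y + z = x + (y + z)"
    by transfer (auto simp: add.assoc)
  show "x + y = y + x"
    by transfer (auto simp: add.commute)
  show "0 + x = x"
    by transfer auto
  show "- x + x = 0"
    unfolding uminus_LL2_def by transfer (auto simp: complex_vector.scale_minus_left)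
  show "x - y = x + - y" by (simp add: minus_LL2_def)
  have 1: "a *\<^sub>C (x + y) = a *\<^sub>C x + a *\<^sub>C y" for a and x y :: LL2
    by transfer (auto simp: scaleC_add_right)
  have 2: "(a + b) *\<^sub>C x = a *\<^sub>C x + b *\<^sub>C x" for a b and x :: LL2
    by transfer (auto simp: scaleC_add_left)
  have 3: "a *\<^sub>C b *\<^sub>C x = (a * b) *\<^sub>C x" for a b and x :: LL2
    by transfer (auto simp: scaleC_scaleC)
  have 4: "1 *\<^sub>C x = x" for x :: LL2
    by transfer (auto simp: scaleC_one)
  have 5: "r *\<^sub>R x = complex_of_real r *\<^sub>C x" for r and x :: LL2
    by (rule scaleR_LL2_def)
  show "r *\<^sub>R (x + y) = r *\<^sub>R x + r *\<^sub>R y" by (simp add: 5 1)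
  show "(r + s) *\<^sub>R x = r *\<^sub>R x + s *\<^sub>R x" by (simp add: 5 2)
  show "r *\<^sub>R s *\<^sub>R x = (r * s) *\<^sub>R x" by (simp add: 5 3)
  show "1 *\<^sub>R x = x" by (simp add: 5 4)
  have 6: "cinner (x + y) z = cinner x z + cinner y z" for x y z :: LL2
    by transfer (auto simp: cinner_add_left intro!: infsum_add summable_cinner)
  have 7: "cinner (a *\<^sub>C x) y = a * cinner x y" for a and x y :: LL2
    by transfer (auto simp: cinner_scaleC_left infsum_cmult_right')
  have 8: "cinner x y = cnj (cinner y x)" for x y :: LL2
    by transfer (simp add: infsum_cnj[symmetric] cinner_commute[symmetric])
  have 9: "inner x y = Re (cinner x y)" for x y :: LL2
    by (rule inner_LL2_def)
  show "inner x y = inner y x" by (subst (1 2) 9, subst 8) simp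
  show "inner (x + y) z = inner x z + inner y z" by (simp add: 9 6)
  show "inner (r *\<^sub>R x) y = r * inner x y" by (simp add: 9 5 7)
  have sq: "(\<Sum>\<^sub>\<infinity>l\<in>I_rat. cinner (f l) (f l)) = complex_of_real (\<Sum>\<^sub>\<infinity>l\<in>I_rat. (norm (f l))\<^sup>2)"
    if "(\<lambda>l. (norm (f l))\<^sup>2) summable_on I_rat" for f :: "real \<Rightarrow> L2"
    unfolding cinner_self using has_sum_bounded_linear[OF bounded_linear_of_real has_sum_infsum[OF that]]
    by (auto intro: infsumI)
  show "0 \<le> inner x x"
    unfolding 9 by transfer (auto simp: sq intro!: infsum_nonneg)
  show "inner x x = 0 \<longleftrightarrow> x = 0"
    unfolding 9
  proof transfer
    fix f :: "real \<Rightarrow> L2"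
    assume f: "(\<forall>l. l \<notin> I_rat \<longrightarrow> f l = 0) \<and> (\<lambda>l. (norm (f l))\<^sup>2) summable_on I_rat"
    have "f l = 0" if "(\<Sum>\<^sub>\<infinity>l\<in>I_rat. (norm (f l))\<^sup>2) = 0" for l
      using nonneg_infsum_le_0D[of "\<lambda>l. (norm (f l))\<^sup>2" I_rat l] that f by auto
    thus "(Re (\<Sum>\<^sub>\<infinity>l\<in>I_rat. cinner (f l) (f l)) = 0) = (f = (\<lambda>_. 0))"
      using f by (auto simp: sq)
  qed
  show "norm x = sqrt (inner x x)" by (rule norm_LL2_def)
  show "sgn x = inverse (norm x) *\<^sub>R x" by (rule sgn_LL2_def)
  show "dist x y = norm (x - y)" by (rule dist_LL2_def)
  show "uniformity = (INF e\<in>{0<..}. principal {(x::LL2, y). dist x y < e})"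
    by (rule uniformity_LL2_def)
  show "open U \<longleftrightarrow> (\<forall>x\<in>U. \<forall>\<^sub>F (x', y) in uniformity. x' = x \<longrightarrow> y \<in> U)"
    by (rule open_LL2_def)
  show "a *\<^sub>C (x + y) = a *\<^sub>C x + a *\<^sub>C y" by (rule 1)
  show "(a + b) *\<^sub>C x = a *\<^sub>C x + b *\<^sub>C x" by (rule 2)
  show "a *\<^sub>C b *\<^sub>C x = (a * b) *\<^sub>C x" by (rule 3)
  show "1 *\<^sub>C x = x" by (rule 4)
  show "r *\<^sub>R x = complex_of_real r *\<^sub>C x" by (rule 5)
  show "cinner (x + y) z = cinner x z + cinner y z" by (rule 6)
  show "cinner (a *\<^sub>C x) y = a * cinner x y" by (rule 7)
  show "cinner x y = cnj (cinner y x)" by (rule 8)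
  show "inner x y = Re (cinner x y)" by (rule 9)
qed

end

definition HH2 :: "LL2 set" where
  "HH2 = {f. \<forall>l\<in>I_rat. component f l \<in> H2}"

text \<open>Only used for \<open>l \<in> I_rat\<close>.\<close>

lift_definition e_vec :: "real \<Rightarrow> int \<Rightarrow> LL2" is
  "\<lambda>l k m. if m = l \<and> l \<in> I_rat then trig k else 0"
proof (intro CollectI conjI allI impI)
  fix l k
  have "(\<lambda>m. (norm (if m = l \<and> l \<in> I_rat then trig k else 0))\<^sup>2) summable_on I_rat \<longleftrightarrow>
      (\<lambda>m. (norm (if m = l \<and> l \<in> I_rat then trig k else 0))\<^sup>2) summable_on (I_rat \<inter> {l})"
    by (rule summable_on_cong_neutral) auto
  thus "(\<lambda>m. (norm (if m = l \<and> l \<in> I_rat then trig k else 0))\<^sup>2) summable_on I_rat"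
    by simp
qed auto

lift_definition mult_LL2 :: "int \<Rightarrow> int \<Rightarrow> LL2 \<Rightarrow> LL2" is
  "\<lambda>j k f l. exp (2 * pi * \<i> * of_int j * of_real l) *\<^sub>C modulate k (f l)"
proof -
  fix j k and f :: "real \<Rightarrow> L2"
  assume f: "(\<forall>l. l \<notin> I_rat \<longrightarrow> f l = 0) \<and> (\<lambda>l. (norm (f l))\<^sup>2) summable_on I_rat"
  have "modulate k 0 = 0"
    using norm_modulate[of k 0] by simp
  moreover have "cmod (exp (2 * pi * \<i> * of_int j * of_real l)) = 1" for l
    by simp
  ultimately show "(\<forall>l. l \<notin> I_rat \<longrightarrow> exp (2 * pi * \<i> * of_int j * of_real l) *\<^sub>C modulate k (f l) = 0) \<and>
      (\<lambda>l. (norm (exp (2 * pi * \<i> * of_int j * of_real l) *\<^sub>C modulate k (f l)))\<^sup>2) summable_on I_rat"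
    using f by (simp add: norm_scaleC norm_modulate)
qed

definition proj_HH2 :: "LL2 \<Rightarrow> LL2" where
  "proj_HH2 = orth_proj HH2"

definition basis_H :: "LL2 set" where
  "basis_H = {e_vec l k | l k. l \<in> I_rat \<and> 0 \<le> k}"


section \<open>Operators with a domain\<close>

text \<open>An operator \<open>T\<close> is a partial function, with domain \<open>dom T\<close>.\<close>

type_synonym op = "LL2 \<rightharpoonup> LL2"

abbreviation app :: "op \<Rightarrow> LL2 \<Rightarrow> LL2" (infixl \<open>\<cdot>\<close> 90) where
  "T \<cdot> x \<equiv> the (T x)"

definition L_HH2 :: "op set" where
  "L_HH2 = {T. complex_vector.subspace (dom T) \<and> dom T \<subseteq> HH2 \<and> ran T \<subseteq> HH2 \<and>
     (\<forall>x\<in>dom T. \<forall>y\<in>dom T. T \<cdot> (x + y) = T \<cdot> x + T \<cdot> y) \<and>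
     (\<forall>a. \<forall>x\<in>dom T. T \<cdot> (a *\<^sub>C x) = a *\<^sub>C (T \<cdot> x)) \<and>
     basis_H \<subseteq> dom T}"

text \<open>The sum of two operators is defined on the intersection of their domains.\<close>

definition op_add :: "op \<Rightarrow> op \<Rightarrow> op" where
  "op_add T S = (\<lambda>x. if x \<in> dom T \<inter> dom S then Some (T \<cdot> x + S \<cdot> x) else None)"

definition op_scale :: "complex \<Rightarrow> op \<Rightarrow> op" where
  "op_scale a T = (\<lambda>x. if x \<in> dom T then Some (a *\<^sub>C (T \<cdot> x)) else None)"

definition op_diff :: "op \<Rightarrow> op \<Rightarrow> op" where
  "op_diff T S = op_add T (op_scale (-1) S)"

definition Tjk :: "int \<Rightarrow> int \<Rightarrow> op" where
  "Tjk j k = (\<lambda>f. if f \<in> HH2 then Some (proj_HH2 (mult_LL2 j k f)) else None)"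

definition E_span :: "op set" where
  "E_span = {(\<lambda>f. if f \<in> HH2 then Some (\<Sum>(j, k)\<in>F. c j k *\<^sub>C (Tjk j k \<cdot> f)) else None) |
     (F :: (int \<times> int) set) (c :: int \<Rightarrow> int \<Rightarrow> complex). finite F}"


section \<open>The seminorm \<open>Q\<close> and the space \<open>\<G>\<close>\<close>

definition I_sub :: "nat \<Rightarrow> real set" where
  "I_sub s = {real j / real s | j. j \<in> {1..s}}"

definition B_set :: "nat \<Rightarrow> LL2 set" where
  "B_set n = {e_vec l k | l k. 0 \<le> k \<and> k \<le> \<lfloor>real n / sqrt (real n)\<rfloor> - 1 \<and> l \<in> I_sub (nat \<lfloor>sqrt (real n)\<rfloor>)}"

definition Q_semi :: "op \<Rightarrow> ereal" where
  "Q_semi T = Inf {limsup (\<lambda>n. ereal (1 / sqrt (real n) * sqrt (\<Sum>x\<in>C n. (norm (T \<cdot> x))\<^sup>2))) | C D.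
     (\<forall>n. C n \<union> D n = B_set n \<and> C n \<inter> D n = {}) \<and>
     (\<lambda>n. 1 / real n * real (card (D n))) \<longlonglongrightarrow> 0}"

definition L_g :: "op set" where
  "L_g = {T \<in> L_HH2. Q_semi T < \<infinity>}"

definition Z_HH2 :: "op set" where
  "Z_HH2 = {T \<in> L_HH2. Q_semi T = 0}"

text \<open>Since operators may have different domains, \<open>L_g\<close> is not literally a vector space; the
  quotient \<open>L_g / Z_HH2\<close> identifies operators whose difference lies in \<open>Z_HH2\<close>.\<close>

definition Z_rel :: "(op \<times> op) set" where
  "Z_rel = {(T, S). T \<in> L_g \<and> S \<in> L_g \<and> op_diff T S \<in> Z_HH2}"

definition cls :: "op \<Rightarrow> op set" where
  "cls T = Z_rel `` {T}"

definition L_G :: "op set set" where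
  "L_G = L_g // Z_rel"

definition cls_add :: "op set \<Rightarrow> op set \<Rightarrow> op set" where
  "cls_add X Y = (\<Union>T\<in>X. \<Union>S\<in>Y. cls (op_add T S))"

definition cls_scale :: "complex \<Rightarrow> op set \<Rightarrow> op set" where
  "cls_scale a X = (\<Union>T\<in>X. cls (op_scale a T))"

definition cls_diff :: "op set \<Rightarrow> op set \<Rightarrow> op set" where
  "cls_diff X Y = cls_add X (cls_scale (-1) Y)"

text \<open>\<open>Q_semi\<close> is constant on each class.\<close>

definition Qtilde :: "op set \<Rightarrow> real" where
  "Qtilde X = (THE q. \<exists>T\<in>X. q = real_of_ereal (Q_semi T))"

text \<open>The closure in \<open>L_G\<close> of the image of \<open>E_span\<close>.\<close>

definition G_space :: "op set set" where
  "G_space = {X \<in> L_G. \<forall>\<epsilon>>0. \<exists>A\<in>E_span. Qtilde (cls_diff X (cls A)) < \<epsilon>}"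

text \<open>The polarization identity, for inner products linear in the first argument.\<close>

definition inner_G :: "op set \<Rightarrow> op set \<Rightarrow> complex" where
  "inner_G X Y = 1 / 4 * (\<Sum>m<4. \<i> ^ m * of_real ((Qtilde (cls_add X (cls_scale (\<i> ^ m) Y)))\<^sup>2))"

end

theory Submission
  imports Defs "HOL-Real_Asymp.Real_Asymp"
begin

text \<open>
  For an operator \<open>R\<close> write \<open>r\<^sub>n(R)\<close> for the square root of
  \<open>1/n (\<Sum>x\<in>B\<^sub>n. \<parallel>R x\<parallel>\<^sup>2)\<close>. By polarization both sides of the claim are the same combination
  of squares for the four operators \<open>R = T + \<i>\<^sup>m S\<close>: the left side of \<open>r\<^sub>n(R)\<^sup>2\<close>, the right side of
  \<open>Q(R)\<^sup>2\<close>. So it is enough that \<open>r\<^sub>n(R)\<close> converges to \<open>Q(R)\<close> for each of them.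

  The seminorm \<open>Q\<close> differs from the upper limit of \<open>r\<^sub>n\<close> only because it may discard exceptional
  sets \<open>D\<^sub>n \<subseteq> B\<^sub>n\<close> of size \<open>o(n)\<close>; such a family is called thin below. The hypothesis says that
  \<open>T\<close> and \<open>S\<close> carry no mass on thin families, and this passes to \<open>R\<close>. For an operator of this kind
  discarding gains nothing, so \<open>Q(R)\<close> is the upper limit of \<open>r\<^sub>n(R)\<close>, and it is the limit as soon as
  there is one (\<open>Q_fun_eq_lim_rms\<close>).

  Convergence is inherited from \<open>E\<close>. Elements of \<open>E\<close> are bounded on the basis, hence carry no mass
  on thin families. If \<open>Q(R - A) < \<epsilon>\<close> then \<open>\<bar>r\<^sub>n(R) - r\<^sub>n(A)\<bar> \<le> r\<^sub>n(R - A) < \<epsilon>\<close> for all large \<open>n\<close>, so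
  \<open>r\<^sub>n(R)\<close> is a Cauchy sequence once every \<open>r\<^sub>n(A)\<close> converges (\<open>rms_tendsto_Q_fun_if_approximable\<close>).

  For \<open>A\<close> in \<open>E\<close>, or for a combination of two elements of \<open>E\<close>, sesquilinearity reduces convergence
  to pairs of generators (\<open>tendsto_mean_cinner_Tjk\<close>). On the basis \<open>T\<^sub>j\<^sub>k e\<^sub>l\<^sub>m\<close> is
  \<open>e\<^bsup>2\<pi>ijl\<^esup> e\<^bsub>l,m+k\<^esub>\<close>, or \<open>0\<close> if \<open>m + k < 0\<close>. With \<open>s = \<lfloor>\<surd>n\<rfloor>\<close> the set \<open>B\<^sub>n\<close> is an
  \<open>s \<times> s\<close> grid, and the average of \<open>\<langle>T\<^sub>j\<^sub>k x, T\<^sub>j\<^sub>'\<^sub>k\<^sub>' x\<rangle>\<close> over it vanishes for \<open>k \<noteq> k'\<close>, vanishes for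
  \<open>j \<noteq> j'\<close> and large \<open>n\<close> because the \<open>s\<close>-th roots of unity sum to zero, and tends to \<open>1\<close> otherwise.

  The quotient by \<open>Z\<close> and the projection \<open>P\<close> have to be made explicit on the way: \<open>Q\<close> is a seminorm,
  so the operations on classes act on representatives, and \<open>P\<close> exists where it is applied because a
  function in \<open>\<H>\<^sup>2\<close> multiplied by \<open>e\<^bsup>ikt\<^esup>\<close> has nonzero Fourier coefficients at only finitely many
  negative indices.
\<close>

section \<open>Complex inner products\<close>

lemma cinner_zero_left [simp]: "cinner 0 (y :: 'a::complex_inner) = 0"
  using cinner_scaleC_left[of 0 0 y] by simp

lemma cinner_zero_right [simp]: "cinner (y :: 'a::complex_inner) 0 = 0"
  using cinner_scaleC_right[of y 0 0] by simp

lemma cinner_diff_left: "cinner (x - z) (y :: 'a::complex_inner) = cinner x y - cinner z y"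
  using cinner_add_left[of "x - z" z y] by simp

lemma cinner_sum_left: "cinner (\<Sum>i\<in>A. f i) (y :: 'a::complex_inner) = (\<Sum>i\<in>A. cinner (f i) y)"
  by (induction A rule: infinite_finite_induct) (auto simp: cinner_add_left)

lemma cinner_add_right: "cinner (x :: 'a::complex_inner) (y + z) = cinner x y + cinner x z"
  by (metis cinner_add_left cinner_commute complex_cnj_add)

lemma cinner_sum_right: "cinner (y :: 'a::complex_inner) (\<Sum>i\<in>A. f i) = (\<Sum>i\<in>A. cinner y (f i))"
  by (subst cinner_commute) (simp add: cinner_sum_left cinner_commute[symmetric])

lemma cinner_polarization:
  fixes x y :: "'a::complex_inner"
  shows "cinner x y = 1 / 4 * (\<Sum>m<4. \<i> ^ m * of_real ((norm (x + \<i> ^ m *\<^sub>C y))\<^sup>2))"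
proof -
  have "of_real ((norm (x + w *\<^sub>C y))\<^sup>2) =
      cinner x x + cnj w * cinner x y + w * cinner y x + w * cnj w * cinner y y" for w
    unfolding cinner_self[symmetric]
    by (simp add: cinner_add_left cinner_add_right cinner_scaleC_left cinner_scaleC_right algebra_simps)
  thus ?thesis
    by (simp only:) (simp add: numeral_eq_Suc lessThan_Suc algebra_simps)
qed

section \<open>Root mean squares\<close>

text \<open>The mean is over \<open>n\<close>, the asymptotic size of the set \<open>B\<^sub>n\<close>, and not over the size of \<open>A\<close>;
  so passing to a subset can only decrease it.\<close>

definition rms :: "nat \<Rightarrow> 'a set \<Rightarrow> ('a \<Rightarrow> 'b::real_normed_vector) \<Rightarrow> real" where
  "rms n A F = L2_set (\<lambda>x. norm (F x)) A / sqrt (real n)"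

lemma rms_nonneg [simp]: "0 \<le> rms n A F"
  by (simp add: rms_def)

lemma rms_cong: "(\<And>x. x \<in> A \<Longrightarrow> norm (F x) = norm (G x)) \<Longrightarrow> rms n A F = rms n A G"
  by (simp add: rms_def cong: L2_set_cong)

lemma rms_power2: "(rms n A F)\<^sup>2 = 1 / real n * (\<Sum>x\<in>A. (norm (F x))\<^sup>2)"
  by (simp add: rms_def L2_set_def power_divide sum_nonneg)

lemma rms_add: "rms n A (\<lambda>x. F x + G x) \<le> rms n A F + rms n A G"
proof -
  have "L2_set (\<lambda>x. norm (F x + G x)) A \<le> L2_set (\<lambda>x. norm (F x) + norm (G x)) A"
    by (intro L2_set_mono norm_triangle_ineq) auto
  also have "\<dots> \<le> L2_set (\<lambda>x. norm (F x)) A + L2_set (\<lambda>x. norm (G x)) A"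
    by (rule L2_set_triangle_ineq)
  finally show ?thesis
    by (simp add: rms_def add_divide_distrib[symmetric] divide_right_mono)
qed

lemma rms_scaleC: "rms n A (\<lambda>x. a *\<^sub>C F x) = cmod a * rms n A F"
  by (simp add: rms_def norm_scaleC L2_set_right_distrib)

lemma rms_mono: "A \<subseteq> B \<Longrightarrow> finite B \<Longrightarrow> rms n A F \<le> rms n B F"
  by (auto simp: rms_def L2_set_def intro!: divide_right_mono sum_mono2)

lemma rms_Un:
  assumes "finite A" "finite B"
  shows "rms n (A \<union> B) F \<le> rms n A F + rms n B F"
proof -
  have "(\<Sum>x\<in>A \<union> B. (norm (F x))\<^sup>2) \<le> (\<Sum>x\<in>A. (norm (F x))\<^sup>2) + (\<Sum>x\<in>B. (norm (F x))\<^sup>2)"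
    by (simp add: sum_Un assms sum_nonneg)
  hence "sqrt (\<Sum>x\<in>A \<union> B. (norm (F x))\<^sup>2) \<le> sqrt ((\<Sum>x\<in>A. (norm (F x))\<^sup>2) + (\<Sum>x\<in>B. (norm (F x))\<^sup>2))"
    by simp
  also have "\<dots> \<le> sqrt (\<Sum>x\<in>A. (norm (F x))\<^sup>2) + sqrt (\<Sum>x\<in>B. (norm (F x))\<^sup>2)"
    by (intro sqrt_add_le_add_sqrt sum_nonneg) auto
  finally show ?thesis
    by (simp add: rms_def L2_set_def add_divide_distrib[symmetric] divide_right_mono)
qed

section \<open>The sets \<open>B\<^sub>n\<close> and their thin subfamilies\<close>

definition grid_size :: "nat \<Rightarrow> nat" where
  "grid_size n = nat \<lfloor>sqrt (real n)\<rfloor>"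

lemma B_set_eq_image:
  "B_set n = (\<lambda>(a, m). e_vec (real a / real (grid_size n)) (int m)) `
     ({1..grid_size n} \<times> {..<grid_size n})"
proof -
  define s where "s = grid_size n"
  have s: "int s = \<lfloor>real n / sqrt (real n)\<rfloor>"
    by (simp add: s_def grid_size_def real_div_sqrt)
  have "B_set n = {e_vec l k | l k. 0 \<le> k \<and> k \<le> int s - 1 \<and> l \<in> I_sub s}"
    unfolding B_set_def s[symmetric] s_def grid_size_def ..
  also have "\<dots> = (\<lambda>(a, m). e_vec (real a / real s) (int m)) ` ({1..s} \<times> {..<s})"
  proof (intro equalityI subsetI)
    fix x assume "x \<in> {e_vec l k | l k. 0 \<le> k \<and> k \<le> int s - 1 \<and> l \<in> I_sub s}"
    then obtain a k where "x = e_vec (real a / real s) k" "0 \<le> k" "k \<le> int s - 1" "a \<in> {1..s}"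
      by (auto simp: I_sub_def)
    thus "x \<in> (\<lambda>(a, m). e_vec (real a / real s) (int m)) ` ({1..s} \<times> {..<s})"
      by (intro image_eqI[of _ _ "(a, nat k)"]) auto
  qed (force simp: I_sub_def)
  finally show ?thesis by (simp only: s_def)
qed

lemma finite_B_set [simp]: "finite (B_set n)"
  by (simp add: B_set_eq_image)

lemma grid_size_le_sqrt: "real (grid_size n) \<le> sqrt (real n)"
  by (simp add: grid_size_def)

lemma card_B_set_le: "card (B_set n) \<le> n"
proof -
  have "card (B_set n) \<le> card ({1..grid_size n} \<times> {..<grid_size n})"
    unfolding B_set_eq_image by (rule card_image_le) simp
  also have "\<dots> = grid_size n * grid_size n" by simp
  also have "\<dots> \<le> n"
  proof -
    have "real (grid_size n) * real (grid_size n) \<le> sqrt (real n) * sqrt (real n)"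
      by (intro mult_mono grid_size_le_sqrt) auto
    thus ?thesis by (simp flip: of_nat_mult)
  qed
  finally show ?thesis .
qed

lemma fraction_in_I_rat: "1 \<le> a \<Longrightarrow> a \<le> s \<Longrightarrow> real a / real s \<in> I_rat"
  by (auto simp: I_rat_def field_simps)

lemma B_set_subset_basis: "B_set n \<subseteq> basis_H"
proof
  fix x assume "x \<in> B_set n"
  then obtain a m where x: "x = e_vec (real a / real (grid_size n)) (int m)" "1 \<le> a" "a \<le> grid_size n"
    by (auto simp: B_set_eq_image)
  moreover have "0 \<le> int m" by simp
  ultimately show "x \<in> basis_H"
    unfolding basis_H_def using fraction_in_I_rat by blast
qed

text \<open>The families of sets that the definition of \<open>Q\<close> allows to be discarded.\<close>

definition thin :: "(nat \<Rightarrow> LL2 set) \<Rightarrow> bool" where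
  "thin D \<longleftrightarrow> (\<forall>n. D n \<subseteq> B_set n) \<and> (\<lambda>n. real (card (D n)) / real n) \<longlonglongrightarrow> 0"

lemma thin_subset: "thin D \<Longrightarrow> D n \<subseteq> B_set n"
  by (simp add: thin_def)

lemma thin_finite: "thin D \<Longrightarrow> finite (D n)"
  using finite_subset[OF thin_subset] by auto

lemma thin_empty: "thin (\<lambda>_. {})"
  by (simp add: thin_def)

lemma thin_Un:
  assumes "thin D" "thin D'"
  shows "thin (\<lambda>n. D n \<union> D' n)"
  unfolding thin_def
proof (intro conjI allI)
  show "D n \<union> D' n \<subseteq> B_set n" for n
    using assms by (simp add: thin_def)
  have lim: "(\<lambda>n. real (card (D n)) / real n + real (card (D' n)) / real n) \<longlonglongrightarrow> 0"
    using assms by (intro tendsto_add_zero) (auto simp: thin_def)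
  have "norm (real (card (D n \<union> D' n)) / real n) \<le>
      real (card (D n)) / real n + real (card (D' n)) / real n" for n
    using card_Un_le[of "D n" "D' n"] by (simp add: add_divide_distrib[symmetric] divide_right_mono)
  thus "(\<lambda>n. real (card (D n \<union> D' n)) / real n) \<longlonglongrightarrow> 0"
    by (intro Lim_null_comparison[OF _ lim] always_eventually allI)
qed

lemma thin_iff_smallo:
  "thin D \<longleftrightarrow> (\<forall>n. D n \<subseteq> B_set n) \<and> (\<lambda>n. real (card (D n))) \<in> o(\<lambda>n. real n)"
proof -
  have "(\<lambda>n. real (card (D n))) \<in> o(\<lambda>n. real n) \<longleftrightarrow> (\<lambda>n. real (card (D n)) / real n) \<longlonglongrightarrow> 0"
    by (auto intro: smalloI_tendsto eventually_sequentiallyI[of 1] dest: smalloD_tendsto)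
  thus ?thesis by (simp add: thin_def)
qed

section \<open>The seminorm \<open>Q\<close>\<close>

text \<open>\<open>Q\<close> as a function of the bare map instead of the partial operator. Sums of operators with
  different domains then become pointwise sums, and only the values on the basis matter.\<close>

definition Q_fun :: "(LL2 \<Rightarrow> LL2) \<Rightarrow> ereal" where
  "Q_fun F = (INF D\<in>Collect thin. limsup (\<lambda>n. ereal (rms n (B_set n - D n) F)))"

lemma Q_semi_eq: "Q_semi T = Q_fun (\<lambda>x. T \<cdot> x)"
proof -
  have "{limsup (\<lambda>n. ereal (1 / sqrt (real n) * sqrt (\<Sum>x\<in>C n. (norm (T \<cdot> x))\<^sup>2))) | C D.
      (\<forall>n. C n \<union> D n = B_set n \<and> C n \<inter> D n = {}) \<and> (\<lambda>n. 1 / real n * real (card (D n))) \<longlonglongrightarrow> 0} =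
    (\<lambda>D. limsup (\<lambda>n. ereal (rms n (B_set n - D n) (\<lambda>x. T \<cdot> x)))) ` Collect thin" (is "?L = ?R")
  proof (intro equalityI subsetI)
    fix q assume "q \<in> ?L"
    then obtain C D where q: "q = limsup (\<lambda>n. ereal (1 / sqrt (real n) * sqrt (\<Sum>x\<in>C n. (norm (T \<cdot> x))\<^sup>2)))"
      and CD: "\<And>n. C n \<union> D n = B_set n" "\<And>n. C n \<inter> D n = {}"
      and D: "(\<lambda>n. 1 / real n * real (card (D n))) \<longlonglongrightarrow> 0"
      by blast
    have "thin D" using CD D by (auto simp: thin_def)
    moreover have "C n = B_set n - D n" for n using CD[of n] by auto
    hence "q = limsup (\<lambda>n. ereal (rms n (B_set n - D n) (\<lambda>x. T \<cdot> x)))"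
      using q by (simp add: rms_def L2_set_def)
    ultimately show "q \<in> ?R" by auto
  next
    fix q assume "q \<in> ?R"
    then obtain D where D: "thin D" "q = limsup (\<lambda>n. ereal (rms n (B_set n - D n) (\<lambda>x. T \<cdot> x)))"
      by auto
    thus "q \<in> ?L"
      by (intro CollectI exI[of _ "\<lambda>n. B_set n - D n"] exI[of _ D])
        (auto simp: rms_def L2_set_def thin_def)
  qed
  thus ?thesis by (simp add: Q_semi_def Q_fun_def)
qed

lemma Q_fun_nonneg: "0 \<le> Q_fun F"
  unfolding Q_fun_def
  by (intro INF_greatest le_Limsup) auto

lemma Q_fun_cong:
  assumes "\<And>x. x \<in> basis_H \<Longrightarrow> F x = G x"
  shows "Q_fun F = Q_fun G"
proof -
  have "rms n (B_set n - D) F = rms n (B_set n - D) G" for n D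
    using assms B_set_subset_basis[of n] by (intro rms_cong) auto
  thus ?thesis by (simp add: Q_fun_def)
qed

text \<open>This and the next lemma trade the upper limits for eventual inequalities between reals.\<close>

lemma Q_fun_lessE:
  assumes "Q_fun F < ereal r"
  obtains D where "thin D" "\<forall>\<^sub>F n in sequentially. rms n (B_set n - D n) F < r"
proof -
  obtain D where "thin D" "limsup (\<lambda>n. ereal (rms n (B_set n - D n) F)) < ereal r"
    using assms unfolding Q_fun_def by (auto simp: INF_less_iff)
  thus ?thesis
    using that[of D] Limsup_lessD[of sequentially "\<lambda>n. ereal (rms n (B_set n - D n) F)" "ereal r"] by auto
qed

lemma Q_fun_leI:
  assumes "thin D" "\<forall>\<^sub>F n in sequentially. rms n (B_set n - D n) F \<le> r"
  shows "Q_fun F \<le> ereal r"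
  unfolding Q_fun_def using assms
  by (intro INF_lower2[of D] Limsup_bounded) auto

text \<open>If \<open>D\<close> is a good choice of exceptional sets for \<open>F\<close> and \<open>D'\<close> one for \<open>G\<close>, then their union is
  still thin and is good for \<open>F + G\<close>.\<close>

lemma Q_fun_add: "Q_fun (\<lambda>x. F x + G x) \<le> Q_fun F + Q_fun G"
proof (cases "Q_fun F = \<infinity> \<or> Q_fun G = \<infinity>")
  case True
  hence "Q_fun F + Q_fun G = \<infinity>" by (elim disjE) simp_all
  thus ?thesis by (simp only: ereal_less_eq)
next
  case False
  then obtain a b where ab: "Q_fun F = ereal a" "Q_fun G = ereal b"
    using Q_fun_nonneg[of F] Q_fun_nonneg[of G] by (cases "Q_fun F"; cases "Q_fun G") auto
  have "Q_fun (\<lambda>x. F x + G x) \<le> ereal (a + b) + ereal e" if "e > 0" for e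
  proof -
    have "Q_fun F < ereal (a + e / 2)" "Q_fun G < ereal (b + e / 2)"
      using ab that by simp_all
    then obtain D D' where D: "thin D" "\<forall>\<^sub>F n in sequentially. rms n (B_set n - D n) F < a + e / 2"
      and D': "thin D'" "\<forall>\<^sub>F n in sequentially. rms n (B_set n - D' n) G < b + e / 2"
      by (elim Q_fun_lessE)
    have "\<forall>\<^sub>F n in sequentially. rms n (B_set n - (D n \<union> D' n)) (\<lambda>x. F x + G x) \<le> a + b + e"
      using D(2) D'(2)
    proof eventually_elim
      case (elim n)
      have "rms n (B_set n - (D n \<union> D' n)) (\<lambda>x. F x + G x) \<le>
          rms n (B_set n - (D n \<union> D' n)) F + rms n (B_set n - (D n \<union> D' n)) G"
        by (rule rms_add)
      also have "\<dots> \<le> rms n (B_set n - D n) F + rms n (B_set n - D' n) G"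
        by (intro add_mono rms_mono) auto
      finally show ?case using elim by linarith
    qed
    thus ?thesis using Q_fun_leI[OF thin_Un[OF D(1) D'(1)]] by simp
  qed
  from ereal_le_epsilon2[OF this] show ?thesis by (simp add: ab)
qed

lemma Q_fun_scaleC:
  assumes "Q_fun F < \<infinity>"
  shows "Q_fun (\<lambda>x. a *\<^sub>C F x) \<le> ereal (cmod a) * Q_fun F"
proof -
  obtain q where q: "Q_fun F = ereal q"
    using assms Q_fun_nonneg[of F] by (cases "Q_fun F") simp_all
  have "Q_fun (\<lambda>x. a *\<^sub>C F x) \<le> ereal (cmod a * q) + ereal e" if "e > 0" for e
  proof -
    \<comment> \<open>The \<open>1\<close> in the denominator covers \<open>a = 0\<close>.\<close>
    define d where "d = e / (cmod a + 1)"
    have d: "d > 0" "cmod a * d \<le> e"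
      using that by (auto simp: d_def field_simps add_pos_nonneg add_nonneg_pos)
    have "Q_fun F < ereal (q + d)" using q d by simp
    then obtain D where D: "thin D" "\<forall>\<^sub>F n in sequentially. rms n (B_set n - D n) F < q + d"
      by (elim Q_fun_lessE)
    have "\<forall>\<^sub>F n in sequentially. rms n (B_set n - D n) (\<lambda>x. a *\<^sub>C F x) \<le> cmod a * q + e"
      using D(2)
    proof eventually_elim
      case (elim n)
      hence "cmod a * rms n (B_set n - D n) F \<le> cmod a * (q + d)"
        by (intro mult_left_mono) auto
      thus ?case using d by (simp add: rms_scaleC distrib_left)
    qed
    thus ?thesis using Q_fun_leI[OF D(1)] by simp
  qed
  from ereal_le_epsilon2[OF this] show ?thesis by (simp add: q)
qed

section \<open>Maps without mass on thin families\<close>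

definition negligible_on_thin :: "(LL2 \<Rightarrow> LL2) \<Rightarrow> bool" where
  "negligible_on_thin F \<longleftrightarrow> (\<forall>D. thin D \<longrightarrow> (\<lambda>n. rms n (D n) F) \<longlonglongrightarrow> 0)"

lemma negligible_on_thin_add:
  assumes "negligible_on_thin F" "negligible_on_thin G"
  shows "negligible_on_thin (\<lambda>x. F x + G x)"
  unfolding negligible_on_thin_def
proof (intro allI impI)
  fix D assume D: "thin D"
  have "(\<lambda>n. rms n (D n) F + rms n (D n) G) \<longlonglongrightarrow> 0"
    using assms D unfolding negligible_on_thin_def by (intro tendsto_add_zero) auto
  thus "(\<lambda>n. rms n (D n) (\<lambda>x. F x + G x)) \<longlonglongrightarrow> 0"
    by (rule Lim_null_comparison[rotated]) (simp add: rms_add)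
qed

lemma negligible_on_thin_scaleC:
  "negligible_on_thin F \<Longrightarrow> negligible_on_thin (\<lambda>x. a *\<^sub>C F x)"
  by (auto simp: negligible_on_thin_def rms_scaleC intro: tendsto_mult_right_zero)

lemma negligible_on_thin_iff:
  "negligible_on_thin F \<longleftrightarrow>
    (\<forall>D. thin D \<longrightarrow> (\<lambda>n. 1 / real n * (\<Sum>x\<in>D n. (norm (F x))\<^sup>2)) \<longlonglongrightarrow> 0)"
proof -
  have "(\<lambda>n. rms n (D n) F) \<longlonglongrightarrow> 0 \<longleftrightarrow> (\<lambda>n. (rms n (D n) F)\<^sup>2) \<longlonglongrightarrow> 0" for D
  proof
    assume "(\<lambda>n. (rms n (D n) F)\<^sup>2) \<longlonglongrightarrow> 0"
    from tendsto_real_sqrt[OF this] show "(\<lambda>n. rms n (D n) F) \<longlonglongrightarrow> 0" by simp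
  next
    assume "(\<lambda>n. rms n (D n) F) \<longlonglongrightarrow> 0"
    from tendsto_power[OF this, of 2] show "(\<lambda>n. (rms n (D n) F)\<^sup>2) \<longlonglongrightarrow> 0" by simp
  qed
  thus ?thesis by (simp only: negligible_on_thin_def rms_power2)
qed

lemma negligible_on_thin_bounded:
  assumes "\<And>x. x \<in> basis_H \<Longrightarrow> norm (F x) \<le> K"
  shows "negligible_on_thin F"
  unfolding negligible_on_thin_iff
proof (intro allI impI)
  fix D assume D: "thin D"
  have lim: "(\<lambda>n. K\<^sup>2 * (real (card (D n)) / real n)) \<longlonglongrightarrow> 0"
    using D unfolding thin_def by (intro tendsto_mult_right_zero) auto
  have "norm (1 / real n * (\<Sum>x\<in>D n. (norm (F x))\<^sup>2)) \<le> K\<^sup>2 * (real (card (D n)) / real n)" for n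
  proof -
    have "(\<Sum>x\<in>D n. (norm (F x))\<^sup>2) \<le> (\<Sum>x\<in>D n. K\<^sup>2)"
      using thin_subset[OF D, of n] B_set_subset_basis[of n]
      by (intro sum_mono power_mono assms) auto
    thus ?thesis by (simp add: divide_right_mono mult.commute sum_nonneg)
  qed
  thus "(\<lambda>n. 1 / real n * (\<Sum>x\<in>D n. (norm (F x))\<^sup>2)) \<longlonglongrightarrow> 0"
    by (intro Lim_null_comparison[OF _ lim] always_eventually allI)
qed

text \<open>The mass on the discarded sets tends to zero, so it can be put back at no asymptotic cost.
  This is where the hypothesis on thin families enters.\<close>

lemma Q_fun_less_imp_rms_less:
  assumes F: "negligible_on_thin F" and r: "Q_fun F < ereal r"
  shows "\<forall>\<^sub>F n in sequentially. rms n (B_set n) F < r"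
proof -
  obtain r' where r': "Q_fun F < ereal r'" "r' < r"
    using r ereal_dense2[OF r] by auto
  obtain D where D: "thin D" "\<forall>\<^sub>F n in sequentially. rms n (B_set n - D n) F < r'"
    using Q_fun_lessE[OF r'(1)] by blast
  have "\<forall>\<^sub>F n in sequentially. rms n (D n) F < r - r'"
    using F D(1) r'(2) unfolding negligible_on_thin_def by (intro order_tendstoD(2)) auto
  with D(2) show ?thesis
  proof eventually_elim
    case (elim n)
    have "B_set n = (B_set n - D n) \<union> D n"
      using thin_subset[OF D(1), of n] by auto
    thus ?case
      using elim rms_Un[of "B_set n - D n" "D n" n F] thin_finite[OF D(1), of n] by simp
  qed
qed

lemma Q_fun_eq_lim_rms:
  assumes F: "negligible_on_thin F" and lim: "(\<lambda>n. rms n (B_set n) F) \<longlonglongrightarrow> r"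
  shows "Q_fun F = ereal r"
proof (rule antisym)
  show "Q_fun F \<le> ereal r"
  proof (rule ereal_le_epsilon2)
    fix e :: real assume "0 < e"
    hence "\<forall>\<^sub>F n in sequentially. rms n (B_set n) F < r + e"
      using order_tendstoD(2)[OF lim, of "r + e"] by simp
    hence "\<forall>\<^sub>F n in sequentially. rms n (B_set n - {}) F \<le> r + e"
      by (rule eventually_mono) simp
    from Q_fun_leI[OF thin_empty this] show "Q_fun F \<le> ereal r + ereal e"
      by simp
  qed
  show "ereal r \<le> Q_fun F"
  proof (rule ccontr)
    assume "\<not> ?thesis"
    hence "Q_fun F < ereal r" by simp
    then obtain r' where r': "Q_fun F < ereal r'" "r' < r"
      using ereal_dense2 by fastforce
    have "\<forall>\<^sub>F n in sequentially. rms n (B_set n) F < r'" "\<forall>\<^sub>F n in sequentially. r' < rms n (B_set n) F"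
      using Q_fun_less_imp_rms_less[OF F r'(1)] order_tendstoD(1)[OF lim r'(2)] .
    hence "\<forall>\<^sub>F n in sequentially. False" by eventually_elim simp
    thus False by simp
  qed
qed

text \<open>Approximation in \<open>Q\<close> gives uniform closeness of the root mean squares for large \<open>n\<close>, since by
  the previous lemmas smallness of \<open>Q(F - G)\<close> is smallness of the root mean squares of \<open>F - G\<close>.
  Convergence therefore passes from the approximants to \<open>F\<close>.\<close>

lemma rms_tendsto_Q_fun_if_approximable:
  assumes F: "negligible_on_thin F"
    and approx: "\<And>e. e > 0 \<Longrightarrow> \<exists>G. negligible_on_thin G \<and> convergent (\<lambda>n. rms n (B_set n) G) \<and>
      Q_fun (\<lambda>x. F x + (-1) *\<^sub>C G x) < ereal e"
  shows "(\<lambda>n. rms n (B_set n) F) \<longlonglongrightarrow> real_of_ereal (Q_fun F)"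
proof -
  have "Cauchy (\<lambda>n. rms n (B_set n) F)"
  proof (rule metric_CauchyI)
    fix e :: real assume "0 < e"
    then obtain G where G: "negligible_on_thin G" "convergent (\<lambda>n. rms n (B_set n) G)"
      "Q_fun (\<lambda>x. F x + (-1) *\<^sub>C G x) < ereal (e / 3)"
      using approx[of "e / 3"] by auto
    define H where "H = (\<lambda>x. F x + (-1) *\<^sub>C G x)"
    have "negligible_on_thin H"
      unfolding H_def by (intro negligible_on_thin_add negligible_on_thin_scaleC F G)
    hence "\<forall>\<^sub>F n in sequentially. rms n (B_set n) H < e / 3"
      using G(3) unfolding H_def by (rule Q_fun_less_imp_rms_less)
    then obtain N where N: "\<And>n. n \<ge> N \<Longrightarrow> rms n (B_set n) H < e / 3"
      by (auto simp: eventually_sequentially)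
    have H: "\<bar>rms n (B_set n) F - rms n (B_set n) G\<bar> \<le> rms n (B_set n) H" for n
    proof -
      have 1: "F = (\<lambda>x. H x + G x)"
        by (auto simp: H_def complex_vector.scale_minus_left scaleC_one)
      have 2: "G = (\<lambda>x. F x + (-1) *\<^sub>C H x)"
        by (auto simp: H_def complex_vector.scale_minus_left scaleC_one)
      show ?thesis
        using rms_add[of n "B_set n" H G] rms_add[of n "B_set n" F "\<lambda>x. (-1) *\<^sub>C H x"]
        unfolding 1[symmetric] 2[symmetric] rms_scaleC by simp
    qed
    obtain M where M: "\<And>m n. m \<ge> M \<Longrightarrow> n \<ge> M \<Longrightarrow> dist (rms m (B_set m) G) (rms n (B_set n) G) < e / 3"
      using G(2) \<open>0 < e\<close> metric_CauchyD[OF convergent_Cauchy, of "\<lambda>n. rms n (B_set n) G" "e / 3"] by auto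
    show "\<exists>M. \<forall>m\<ge>M. \<forall>n\<ge>M. dist (rms m (B_set m) F) (rms n (B_set n) F) < e"
    proof (intro exI[of _ "max M N"] allI impI)
      fix m n assume "max M N \<le> m" "max M N \<le> n"
      thus "dist (rms m (B_set m) F) (rms n (B_set n) F) < e"
        using M[of m n] H[of m] H[of n] N[of m] N[of n] unfolding dist_real_def
        by (simp add: abs_if split: if_splits)
    qed
  qed
  then obtain r where r: "(\<lambda>n. rms n (B_set n) F) \<longlonglongrightarrow> r"
    by (auto simp: Cauchy_convergent_iff convergent_def)
  with Q_fun_eq_lim_rms[OF F r] show ?thesis by simp
qed

section \<open>Fourier coefficients\<close>

lemma integral_exp_ikt:
  "(LINT t|lebesgue_on {-pi..pi}. exp (\<i> * of_int k * complex_of_real t)) = (if k = 0 then 2 * pi else 0)"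
proof (cases "k = 0")
  case True
  thus ?thesis by (simp add: scaleR_conv_of_real measure_restrict_space)
next
  case False
  let ?f = "\<lambda>t::real. exp (\<i> * of_int k * complex_of_real t)"
  let ?F = "\<lambda>t::real. ?f t / (\<i> * of_int k)"
  have "(?f has_integral ?F pi - ?F (-pi)) {-pi..pi}"
  proof (rule fundamental_theorem_of_calculus)
    fix t :: real assume "t \<in> {-pi..pi}"
    have "((\<lambda>z. exp (\<i> * of_int k * z) / (\<i> * of_int k)) has_field_derivative exp (\<i> * of_int k * of_real t)) (at (of_real t))"
      using False by (auto intro!: derivative_eq_intros)
    from has_vector_derivative_real_field[OF this]
    show "(?F has_vector_derivative ?f t) (at t within {-pi..pi})" .
  qed simp
  moreover have "exp (\<i> * of_int k * complex_of_real pi) = exp (\<i> * of_int k * complex_of_real (-pi))"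
    unfolding exp_eq by (intro exI[of _ k]) (simp add: algebra_simps)
  ultimately have "(?f has_integral 0) {-pi..pi}" by simp
  moreover have "integrable (lebesgue_on {-pi..pi}) ?f"
    by (intro continuous_imp_integrable_real continuous_intros) 
  ultimately show ?thesis
    using False by (simp add: lebesgue_integral_eq_integral integral_unique)
qed

lemma cinner_trig: "cinner (trig j) (trig k) = (if j = k then 1 else 0)"
proof (transfer)
  fix j k :: int
  have "exp (\<i> * of_int j * complex_of_real t) * cnj (exp (\<i> * of_int k * complex_of_real t)) =
      exp (\<i> * of_int (j - k) * complex_of_real t)" for t
    by (simp add: exp_cnj exp_add[symmetric] algebra_simps exp_minus[symmetric])
  thus "complex_of_real (1 / (2 * pi)) * (LINT t|lebesgue_on {-pi..pi}.
      exp (\<i> * of_int j * complex_of_real t) * cnj (exp (\<i> * of_int k * complex_of_real t))) = (if j = k then 1 else 0)"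
    by (simp only: integral_exp_ikt) simp
qed

lemma norm_trig [simp]: "norm (trig k) = 1"
  by (simp add: norm_eq_sqrt_inner inner_cinner cinner_trig)

lemma cinner_modulate_trig: "cinner (modulate k f) (trig m) = cinner f (trig (m - k))"
proof transfer
  fix k m f
  have "exp (\<i> * of_int k * complex_of_real t) * f t * cnj (exp (\<i> * of_int m * complex_of_real t)) =
      f t * cnj (exp (\<i> * of_int (m - k) * complex_of_real t))" for t
    by (simp add: exp_cnj algebra_simps exp_diff exp_minus field_simps)
  thus "complex_of_real (1 / (2 * pi)) * (LINT t|lebesgue_on {-pi..pi}.
      exp (\<i> * of_int k * complex_of_real t) * f t * cnj (exp (\<i> * of_int m * complex_of_real t))) =
    complex_of_real (1 / (2 * pi)) * (LINT t|lebesgue_on {-pi..pi}.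
      f t * cnj (exp (\<i> * of_int (m - k) * complex_of_real t)))"
    by (simp only:)
qed

lemma modulate_trig: "modulate k (trig m) = trig (k + m)"
proof transfer
  fix k m
  have "(\<lambda>t. exp (\<i> * of_int k * complex_of_real t) * exp (\<i> * of_int m * complex_of_real t)) =
      (\<lambda>t. exp (\<i> * of_int (k + m) * complex_of_real t))"
    by (simp add: exp_add[symmetric] algebra_simps)
  thus "L2_rel (\<lambda>t. exp (\<i> * of_int k * complex_of_real t) * exp (\<i> * of_int m * complex_of_real t))
     (\<lambda>t. exp (\<i> * of_int (k + m) * complex_of_real t))"
    using sq_integrable_exp[of "k + m"] by (simp add: L2_rel_def)
qed

lemma modulate_add: "modulate k (f + g) = modulate k f + modulate k g"
  by transfer (auto simp: L2_rel_def distrib_left intro!: sq_integrable_exp_mult sq_integrable_add)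

lemma modulate_scaleC: "modulate k (a *\<^sub>C f) = a *\<^sub>C modulate k f"
  by transfer (auto simp: L2_rel_def intro!: sq_integrable_exp_mult sq_integrable_scale)

lemma modulate_zero [simp]: "modulate k 0 = 0"
  using norm_modulate[of k 0] by simp

lemma component_add: "component (f + g) l = component f l + component g l"
  by (simp add: plus_LL2.rep_eq)

lemma component_scaleC: "component (a *\<^sub>C f) l = a *\<^sub>C component f l"
  by (simp add: scaleC_LL2.rep_eq)

lemma cinner_e_vec:
  assumes "l \<in> I_rat"
  shows "cinner f (e_vec l k) = cinner (component f l) (trig k)"
proof -
  have "cinner f (e_vec l k) = (\<Sum>\<^sub>\<infinity>m\<in>I_rat. cinner (component f m) (component (e_vec l k) m))"
    by (rule cinner_LL2.rep_eq)
  also have "\<dots> = (\<Sum>\<^sub>\<infinity>m\<in>{l}. cinner (component f m) (component (e_vec l k) m))"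
    using assms by (intro infsum_cong_neutral) (auto simp: e_vec.rep_eq)
  finally show ?thesis using assms by (simp add: e_vec.rep_eq)
qed

lemma cinner_e_vec_same: "l \<in> I_rat \<Longrightarrow> cinner (e_vec l j) (e_vec l k) = (if j = k then 1 else 0)"
  by (simp add: cinner_e_vec e_vec.rep_eq cinner_trig)

lemma e_vec_inject:
  assumes "l \<in> I_rat" "l' \<in> I_rat" "e_vec l k = e_vec l' k'"
  shows "l = l' \<and> k = k'"
proof -
  have 1: "cinner (e_vec l k) (e_vec l' k') = 1"
    using assms by (simp add: cinner_e_vec_same)
  have "l = l'"
  proof (rule ccontr)
    assume "l \<noteq> l'"
    hence "cinner (e_vec l k) (e_vec l' k') = cinner 0 (trig k')"
      using assms(2) by (simp add: cinner_e_vec e_vec.rep_eq)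
    also have "\<dots> = 0"
      using cinner_scaleC_left[of 0 0 "trig k'"] by simp
    finally show False using 1 by simp
  qed
  with 1 assms show ?thesis by (auto simp: cinner_e_vec_same split: if_splits)
qed

section \<open>The projection onto \<open>\<H>\<^sup>2\<close>\<close>

lemma HH2_iff: "f \<in> HH2 \<longleftrightarrow> (\<forall>l\<in>I_rat. \<forall>k<0. cinner f (e_vec l k) = 0)"
  by (auto simp: HH2_def H2_def cinner_e_vec)

lemma subspace_HH2: "complex_vector.subspace HH2"
  by (auto simp: complex_vector.subspace_def HH2_iff cinner_add_left cinner_scaleC_left)

text \<open>The orthogonal projection onto the closed span of the \<open>e\<^sub>l\<^sub>m\<close> with \<open>m\<close> fixed and \<open>l\<close>
  arbitrary.\<close>

lift_definition fourier_mode :: "int \<Rightarrow> LL2 \<Rightarrow> LL2" is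
  "\<lambda>m f l. cinner (f l) (trig m) *\<^sub>C trig m"
proof (intro conjI allI impI)
  fix m and f :: "real \<Rightarrow> L2"
  assume f: "(\<forall>l. l \<notin> I_rat \<longrightarrow> f l = 0) \<and> (\<lambda>l. (norm (f l))\<^sup>2) summable_on I_rat"
  show "cinner (f l) (trig m) *\<^sub>C trig m = 0" if "l \<notin> I_rat" for l
    using f that by simp
  show "(\<lambda>l. (norm (cinner (f l) (trig m) *\<^sub>C trig m))\<^sup>2) summable_on I_rat"
  proof (rule summable_on_comparison_test)
    show "(\<lambda>l. (norm (f l))\<^sup>2) summable_on I_rat" using f by simp
    show "(norm (cinner (f l) (trig m) *\<^sub>C trig m))\<^sup>2 \<le> (norm (f l))\<^sup>2" for l
      using complex_Cauchy_Schwarz[of "f l" "trig m"] by (simp add: norm_scaleC power_mono)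
  qed auto
qed

lemma cinner_fourier_mode_e_vec:
  "l \<in> I_rat \<Longrightarrow> cinner (fourier_mode m f) (e_vec l k) = (if m = k then cinner f (e_vec l k) else 0)"
  by (simp add: cinner_e_vec fourier_mode.rep_eq cinner_scaleC_left cinner_trig)

lemma cinner_fourier_mode_HH2:
  assumes "m < 0" "z \<in> HH2"
  shows "cinner (fourier_mode m f) z = 0"
proof -
  have "cinner (component (fourier_mode m f) l) (component z l) = 0" if "l \<in> I_rat" for l
  proof -
    have "cinner (component z l) (trig m) = 0"
      using assms that by (auto simp: HH2_def H2_def)
    thus ?thesis
      by (subst cinner_commute) (simp add: fourier_mode.rep_eq cinner_scaleC_right)
  qed
  thus ?thesis by (simp add: cinner_LL2.rep_eq infsum_0)
qed

lemma proj_HH2_eqI: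
  assumes "y \<in> HH2" "\<And>z. z \<in> HH2 \<Longrightarrow> cinner (x - y) z = 0"
  shows "proj_HH2 x = y"
  unfolding proj_HH2_def orth_proj_def
proof (rule the_equality)
  fix y' assume y': "y' \<in> HH2 \<and> (\<forall>z\<in>HH2. cinner (x - y') z = 0)"
  have "y' - y \<in> HH2"
    using y' assms(1) by (auto intro: complex_vector.subspace_diff subspace_HH2)
  hence "cinner (x - y) (y' - y) - cinner (x - y') (y' - y) = 0"
    using y' assms(2) by simp
  hence "cinner (y' - y) (y' - y) = 0"
    by (simp add: cinner_diff_left[symmetric])
  thus "y' = y" by (simp add: cinner_self)
qed (use assms in auto)

text \<open>With only finitely many negative modes, subtracting these modes gives a vector of \<open>\<H>\<^sup>2\<close>,
  and what was subtracted is orthogonal to \<open>\<H>\<^sup>2\<close>.\<close>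

lemma proj_HH2_in_and_orthogonal:
  assumes f: "\<And>l k. l \<in> I_rat \<Longrightarrow> k < - K \<Longrightarrow> cinner f (e_vec l k) = 0"
  shows "proj_HH2 f \<in> HH2 \<and> (\<forall>z\<in>HH2. cinner (f - proj_HH2 f) z = 0)"
proof -
  define y where "y = f - (\<Sum>m\<in>{-K..-1}. fourier_mode m f)"
  have y: "y \<in> HH2"
    unfolding HH2_iff
  proof (intro ballI allI impI)
    fix l and k :: int assume l: "l \<in> I_rat" and k: "k < 0"
    have "cinner y (e_vec l k) =
        cinner f (e_vec l k) - (\<Sum>m\<in>{-K..-1}. if m = k then cinner f (e_vec l k) else 0)"
      by (simp add: y_def cinner_diff_left cinner_sum_left cinner_fourier_mode_e_vec l)
    thus "cinner y (e_vec l k) = 0"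
      using f[OF l, of k] k by (cases "k < -K") auto
  qed
  have orth: "cinner (f - y) z = 0" if "z \<in> HH2" for z
    using that by (simp add: y_def cinner_sum_left cinner_fourier_mode_HH2)
  show ?thesis using proj_HH2_eqI[OF y orth] y orth by simp
qed

section \<open>The operators \<open>T\<^sub>j\<^sub>k\<close>\<close>

lemma cinner_mult_LL2_e_vec:
  "l \<in> I_rat \<Longrightarrow> cinner (mult_LL2 j k f) (e_vec l m) =
     exp (2 * pi * \<i> * of_int j * of_real l) * cinner f (e_vec l (m - k))"
  by (simp add: cinner_e_vec mult_LL2.rep_eq cinner_scaleC_left cinner_modulate_trig)

lemma mult_LL2_add: "mult_LL2 j k (f + g) = mult_LL2 j k f + mult_LL2 j k g"
  by (simp add: component_inject[symmetric] fun_eq_iff mult_LL2.rep_eq component_add modulate_add scaleC_add_right)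

lemma mult_LL2_scaleC: "mult_LL2 j k (a *\<^sub>C f) = a *\<^sub>C mult_LL2 j k f"
  by (simp add: component_inject[symmetric] fun_eq_iff mult_LL2.rep_eq component_scaleC modulate_scaleC
      scaleC_scaleC mult.commute)

lemma mult_LL2_e_vec:
  "mult_LL2 j k (e_vec l m) = exp (2 * pi * \<i> * of_int j * of_real l) *\<^sub>C e_vec l (k + m)"
  by (simp add: component_inject[symmetric] fun_eq_iff mult_LL2.rep_eq component_scaleC e_vec.rep_eq modulate_trig)

text \<open>Multiplication by \<open>e\<^bsup>ikt\<^esup>\<close> shifts the Fourier coefficients by \<open>k\<close>, so it creates no modes below
  \<open>-\<bar>k\<bar>\<close>.\<close>

lemma proj_mult_LL2:
  assumes "f \<in> HH2"
  shows "proj_HH2 (mult_LL2 j k f) \<in> HH2"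
    and "z \<in> HH2 \<Longrightarrow> cinner (mult_LL2 j k f - proj_HH2 (mult_LL2 j k f)) z = 0"
proof -
  have "cinner (mult_LL2 j k f) (e_vec l m) = 0" if "l \<in> I_rat" "m < - \<bar>k\<bar>" for l m
    using that assms by (simp add: cinner_mult_LL2_e_vec HH2_iff)
  from proj_HH2_in_and_orthogonal[OF this]
  show "proj_HH2 (mult_LL2 j k f) \<in> HH2"
    "z \<in> HH2 \<Longrightarrow> cinner (mult_LL2 j k f - proj_HH2 (mult_LL2 j k f)) z = 0" by auto
qed

lemma Tjk_app: "f \<in> HH2 \<Longrightarrow> Tjk j k \<cdot> f = proj_HH2 (mult_LL2 j k f)"
  by (simp add: Tjk_def)

lemma Tjk_in_HH2: "f \<in> HH2 \<Longrightarrow> Tjk j k \<cdot> f \<in> HH2"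
  by (simp add: Tjk_app proj_mult_LL2)

lemma Tjk_add:
  assumes "f \<in> HH2" "g \<in> HH2"
  shows "Tjk j k \<cdot> (f + g) = Tjk j k \<cdot> f + Tjk j k \<cdot> g"
proof -
  have "proj_HH2 (mult_LL2 j k (f + g)) = proj_HH2 (mult_LL2 j k f) + proj_HH2 (mult_LL2 j k g)"
  proof (rule proj_HH2_eqI)
    show "proj_HH2 (mult_LL2 j k f) + proj_HH2 (mult_LL2 j k g) \<in> HH2"
      using assms by (intro complex_vector.subspace_add subspace_HH2 proj_mult_LL2)
    fix z assume "z \<in> HH2"
    thus "cinner (mult_LL2 j k (f + g) - (proj_HH2 (mult_LL2 j k f) + proj_HH2 (mult_LL2 j k g))) z = 0"
      using proj_mult_LL2(2)[OF assms(1), of z j k] proj_mult_LL2(2)[OF assms(2), of z j k]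
      by (simp add: mult_LL2_add cinner_diff_left cinner_add_left)
  qed
  thus ?thesis
    using assms complex_vector.subspace_add[OF subspace_HH2] by (simp add: Tjk_app)
qed

lemma Tjk_scaleC:
  assumes "f \<in> HH2"
  shows "Tjk j k \<cdot> (a *\<^sub>C f) = a *\<^sub>C (Tjk j k \<cdot> f)"
proof -
  have "proj_HH2 (mult_LL2 j k (a *\<^sub>C f)) = a *\<^sub>C proj_HH2 (mult_LL2 j k f)"
  proof (rule proj_HH2_eqI)
    show "a *\<^sub>C proj_HH2 (mult_LL2 j k f) \<in> HH2"
      using assms by (intro complex_vector.subspace_scale subspace_HH2 proj_mult_LL2)
    fix z assume "z \<in> HH2"
    thus "cinner (mult_LL2 j k (a *\<^sub>C f) - a *\<^sub>C proj_HH2 (mult_LL2 j k f)) z = 0"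
      using proj_mult_LL2(2)[OF assms(1), of z j k]
      by (simp add: mult_LL2_scaleC cinner_diff_left cinner_scaleC_left)
  qed
  thus ?thesis
    using assms complex_vector.subspace_scale[OF subspace_HH2] by (simp add: Tjk_app)
qed

lemma e_vec_in_HH2: "l \<in> I_rat \<Longrightarrow> 0 \<le> m \<Longrightarrow> e_vec l m \<in> HH2"
  unfolding HH2_def H2_def by (auto simp: e_vec.rep_eq cinner_trig)

lemma Tjk_e_vec:
  assumes "l \<in> I_rat" "0 \<le> m"
  shows "Tjk j k \<cdot> e_vec l m =
    (if 0 \<le> k + m then exp (2 * pi * \<i> * of_int j * of_real l) *\<^sub>C e_vec l (k + m) else 0)"
proof -
  have "proj_HH2 (mult_LL2 j k (e_vec l m)) =
    (if 0 \<le> k + m then exp (2 * pi * \<i> * of_int j * of_real l) *\<^sub>C e_vec l (k + m) else 0)"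
  proof (rule proj_HH2_eqI)
    show "(if 0 \<le> k + m then exp (2 * pi * \<i> * of_int j * of_real l) *\<^sub>C e_vec l (k + m) else 0) \<in> HH2"
      using assms complex_vector.subspace_scale[OF subspace_HH2 e_vec_in_HH2]
      by (auto simp: complex_vector.subspace_0[OF subspace_HH2])
    fix z assume z: "z \<in> HH2"
    show "cinner (mult_LL2 j k (e_vec l m) - (if 0 \<le> k + m then
        exp (2 * pi * \<i> * of_int j * of_real l) *\<^sub>C e_vec l (k + m) else 0)) z = 0"
    proof (cases "0 \<le> k + m")
      case False
      have "cinner (e_vec l (k + m)) z = cnj (cinner z (e_vec l (k + m)))"
        by (rule cinner_commute)
      also have "\<dots> = 0" using z False assms by (simp add: HH2_iff)
      finally show ?thesis using False by (simp add: mult_LL2_e_vec cinner_scaleC_left)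
    qed (simp add: mult_LL2_e_vec)
  qed
  thus ?thesis using e_vec_in_HH2[OF assms] by (simp add: Tjk_app)
qed

section \<open>The quotient by \<open>Z\<close>\<close>

lemma op_add_app: "x \<in> dom T \<Longrightarrow> x \<in> dom S \<Longrightarrow> op_add T S \<cdot> x = T \<cdot> x + S \<cdot> x"
  by (simp add: op_add_def)

lemma dom_op_add: "dom (op_add T S) = dom T \<inter> dom S"
  by (auto simp: op_add_def split: if_splits)

lemma op_scale_app: "x \<in> dom T \<Longrightarrow> op_scale a T \<cdot> x = a *\<^sub>C (T \<cdot> x)"
  by (simp add: op_scale_def)

lemma dom_op_scale: "dom (op_scale a T) = dom T"
  by (auto simp: op_scale_def split: if_splits)

lemma L_HH2_dom: "T \<in> L_HH2 \<Longrightarrow> x \<in> basis_H \<Longrightarrow> x \<in> dom T"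
  by (auto simp: L_HH2_def)

lemma L_HH2_app: "T \<in> L_HH2 \<Longrightarrow> x \<in> dom T \<Longrightarrow> T \<cdot> x \<in> HH2"
  by (auto simp: L_HH2_def ran_def)

lemma op_add_in_L_HH2:
  assumes T: "T \<in> L_HH2" and S: "S \<in> L_HH2"
  shows "op_add T S \<in> L_HH2"
proof -
  have sub: "complex_vector.subspace (dom T)" "complex_vector.subspace (dom S)"
    using T S by (auto simp: L_HH2_def)
  have "ran (op_add T S) \<subseteq> HH2"
  proof
    fix y assume "y \<in> ran (op_add T S)"
    then obtain x where "x \<in> dom T" "x \<in> dom S" "y = T \<cdot> x + S \<cdot> x"
      by (auto simp: ran_def op_add_def split: if_splits)
    thus "y \<in> HH2"
      using L_HH2_app[OF T, of x] L_HH2_app[OF S, of x] complex_vector.subspace_add[OF subspace_HH2] by simp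
  qed
  moreover have "op_add T S \<cdot> (x + y) = op_add T S \<cdot> x + op_add T S \<cdot> y"
    if "x \<in> dom T \<inter> dom S" "y \<in> dom T \<inter> dom S" for x y
    using that T S complex_vector.subspace_add[OF sub(1), of x y] complex_vector.subspace_add[OF sub(2), of x y]
    by (simp add: op_add_app L_HH2_def)
  moreover have "op_add T S \<cdot> (a *\<^sub>C x) = a *\<^sub>C (op_add T S \<cdot> x)"
    if "x \<in> dom T \<inter> dom S" for a x
    using that T S complex_vector.subspace_scale[OF sub(1), of x a] complex_vector.subspace_scale[OF sub(2), of x a]
    by (simp add: op_add_app L_HH2_def scaleC_add_right)
  ultimately show ?thesis
    using T S by (auto simp: L_HH2_def dom_op_add intro: complex_vector.subspace_inter)
qed

lemma op_scale_in_L_HH2: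
  assumes T: "T \<in> L_HH2"
  shows "op_scale a T \<in> L_HH2"
proof -
  have sub: "complex_vector.subspace (dom T)"
    using T by (auto simp: L_HH2_def)
  have "ran (op_scale a T) \<subseteq> HH2"
  proof
    fix y assume "y \<in> ran (op_scale a T)"
    then obtain x where "x \<in> dom T" "y = a *\<^sub>C (T \<cdot> x)"
      by (auto simp: ran_def op_scale_def split: if_splits)
    thus "y \<in> HH2"
      using L_HH2_app[OF T, of x] complex_vector.subspace_scale[OF subspace_HH2] by simp
  qed
  moreover have "op_scale a T \<cdot> (x + y) = op_scale a T \<cdot> x + op_scale a T \<cdot> y"
    if "x \<in> dom T" "y \<in> dom T" for x y
    using that T complex_vector.subspace_add[OF sub, of x y]
    by (simp add: op_scale_app L_HH2_def scaleC_add_right)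
  moreover have "op_scale a T \<cdot> (b *\<^sub>C x) = b *\<^sub>C (op_scale a T \<cdot> x)"
    if "x \<in> dom T" for b x
    using that T complex_vector.subspace_scale[OF sub, of x b]
    by (simp add: op_scale_app L_HH2_def scaleC_scaleC mult.commute)
  ultimately show ?thesis
    using T sub by (auto simp: L_HH2_def dom_op_scale)
qed

lemma op_diff_in_L_HH2: "T \<in> L_HH2 \<Longrightarrow> S \<in> L_HH2 \<Longrightarrow> op_diff T S \<in> L_HH2"
  by (simp add: op_diff_def op_add_in_L_HH2 op_scale_in_L_HH2)

lemma op_add_app_basis:
  "T \<in> L_HH2 \<Longrightarrow> S \<in> L_HH2 \<Longrightarrow> x \<in> basis_H \<Longrightarrow> op_add T S \<cdot> x = T \<cdot> x + S \<cdot> x"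
  by (simp add: op_add_app L_HH2_dom)

lemma op_scale_app_basis:
  "T \<in> L_HH2 \<Longrightarrow> x \<in> basis_H \<Longrightarrow> op_scale a T \<cdot> x = a *\<^sub>C (T \<cdot> x)"
  by (simp add: op_scale_app L_HH2_dom)

lemma op_diff_app_basis:
  "T \<in> L_HH2 \<Longrightarrow> S \<in> L_HH2 \<Longrightarrow> x \<in> basis_H \<Longrightarrow> op_diff T S \<cdot> x = T \<cdot> x - S \<cdot> x"
  by (simp add: op_diff_def op_add_app_basis op_scale_app_basis op_scale_in_L_HH2
      complex_vector.scale_minus_left scaleC_one)

lemma Q_semi_nonneg: "0 \<le> Q_semi T"
  by (simp add: Q_semi_eq Q_fun_nonneg)

text \<open>The sum is required only on the basis. In this form the lemma applies to expressions such as
  \<open>(T - S) + (S - R)\<close>, whose domain may be smaller than that of \<open>T - R\<close>.\<close>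

lemma Q_semi_le_add:
  assumes "\<And>x. x \<in> basis_H \<Longrightarrow> R \<cdot> x = T \<cdot> x + S \<cdot> x"
  shows "Q_semi R \<le> Q_semi T + Q_semi S"
  using Q_fun_add[of "\<lambda>x. T \<cdot> x" "\<lambda>x. S \<cdot> x"] Q_fun_cong[of "\<lambda>x. R \<cdot> x" "\<lambda>x. T \<cdot> x + S \<cdot> x"] assms
  by (simp add: Q_semi_eq)

lemma Q_semi_le_scale:
  assumes "\<And>x. x \<in> basis_H \<Longrightarrow> R \<cdot> x = a *\<^sub>C (T \<cdot> x)" "Q_semi T < \<infinity>"
  shows "Q_semi R \<le> ereal (cmod a) * Q_semi T"
  using Q_fun_scaleC[of "\<lambda>x. T \<cdot> x" a] Q_fun_cong[of "\<lambda>x. R \<cdot> x" "\<lambda>x. a *\<^sub>C (T \<cdot> x)"] assms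
  by (simp add: Q_semi_eq)

lemma Q_semi_add_zero:
  assumes "\<And>x. x \<in> basis_H \<Longrightarrow> R \<cdot> x = T \<cdot> x + S \<cdot> x" "Q_semi T = 0" "Q_semi S = 0"
  shows "Q_semi R = 0"
  using Q_semi_le_add[of R T S] assms Q_semi_nonneg[of R] by simp

lemma Q_semi_scale_zero:
  assumes "\<And>x. x \<in> basis_H \<Longrightarrow> R \<cdot> x = a *\<^sub>C (T \<cdot> x)" "Q_semi T = 0"
  shows "Q_semi R = 0"
  using Q_semi_le_scale[of R a T] assms Q_semi_nonneg[of R] by simp

lemma L_gD: "T \<in> L_g \<Longrightarrow> T \<in> L_HH2"
  by (simp add: L_g_def)

lemma op_add_in_L_g:
  assumes "T \<in> L_g" "S \<in> L_g"
  shows "op_add T S \<in> L_g"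
proof -
  have "Q_semi (op_add T S) \<le> Q_semi T + Q_semi S"
    by (rule Q_semi_le_add) (simp add: assms L_gD op_add_app_basis)
  also have "\<dots> < \<infinity>"
    using assms by (auto simp: L_g_def)
  finally show ?thesis using assms by (simp add: L_g_def op_add_in_L_HH2)
qed

lemma op_scale_in_L_g:
  assumes "T \<in> L_g"
  shows "op_scale a T \<in> L_g"
proof -
  have "Q_semi (op_scale a T) \<le> ereal (cmod a) * Q_semi T"
    using assms by (intro Q_semi_le_scale) (auto simp: L_g_def op_scale_app_basis)
  also have "\<dots> < \<infinity>"
    using assms Q_semi_nonneg[of T] by (cases "Q_semi T") (auto simp: L_g_def)
  finally show ?thesis using assms by (simp add: L_g_def op_scale_in_L_HH2)
qed

lemma Z_rel_iff: "(T, S) \<in> Z_rel \<longleftrightarrow> T \<in> L_g \<and> S \<in> L_g \<and> Q_semi (op_diff T S) = 0"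
  by (auto simp: Z_rel_def Z_HH2_def L_gD op_diff_in_L_HH2)

text \<open>Differences of operators obey the usual identities only up to domains: \<open>op_diff T T\<close> is the
  zero operator on the domain of \<open>T\<close>. The identities do hold on the basis, which is all that \<open>Q\<close>
  depends on.\<close>

lemma equiv_Z_rel: "equiv L_g Z_rel"
proof (rule equivI)
  show "Z_rel \<subseteq> L_g \<times> L_g" by (auto simp: Z_rel_iff)
  show "refl_on L_g Z_rel"
  proof (rule refl_onI)
    fix T assume T: "T \<in> L_g"
    have "Q_semi (op_diff T T) = 0"
    proof -
      have "Q_semi (op_diff T T) \<le> ereal (cmod 0) * Q_semi T"
        using T by (intro Q_semi_le_scale) (auto simp: L_g_def op_diff_app_basis)
      also have "ereal (cmod 0) * Q_semi T = 0"
        by (simp add: zero_ereal_def[symmetric])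
      finally show ?thesis using Q_semi_nonneg[of "op_diff T T"] by (rule antisym)
    qed
    thus "(T, T) \<in> Z_rel" using T by (simp add: Z_rel_iff)
  qed
  show "sym Z_rel"
  proof (rule symI)
    fix T S assume *: "(T, S) \<in> Z_rel"
    hence "Q_semi (op_diff S T) = 0"
      by (intro Q_semi_scale_zero[of "op_diff S T" "-1" "op_diff T S"])
        (auto simp: Z_rel_iff L_gD op_diff_app_basis complex_vector.scale_minus_left scaleC_one)
    thus "(S, T) \<in> Z_rel" using * by (simp add: Z_rel_iff)
  qed
  show "trans Z_rel"
  proof (rule transI)
    fix T S R assume *: "(T, S) \<in> Z_rel" "(S, R) \<in> Z_rel"
    hence "Q_semi (op_diff T R) = 0"
      by (intro Q_semi_add_zero[of "op_diff T R" "op_diff T S" "op_diff S R"])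
        (auto simp: Z_rel_iff L_gD op_diff_app_basis)
    thus "(T, R) \<in> Z_rel" using * by (simp add: Z_rel_iff)
  qed
qed

lemma cls_eqI: "(T, S) \<in> Z_rel \<Longrightarrow> cls T = cls S"
  unfolding cls_def by (rule equiv_class_eq[OF equiv_Z_rel])

lemma self_in_cls: "T \<in> L_g \<Longrightarrow> T \<in> cls T"
  unfolding cls_def by (rule equiv_class_self[OF equiv_Z_rel])

lemma mem_cls_iff: "S \<in> cls T \<longleftrightarrow> (T, S) \<in> Z_rel"
  by (simp add: cls_def)

lemma cls_add_eq:
  assumes "T \<in> L_g" "S \<in> L_g"
  shows "cls_add (cls T) (cls S) = cls (op_add T S)"
proof -
  have "cls (op_add T' S') = cls (op_add T S)" if T': "T' \<in> cls T" and S': "S' \<in> cls S" for T' S'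
  proof (rule cls_eqI[symmetric])
    have Z: "(T, T') \<in> Z_rel" "(S, S') \<in> Z_rel"
      using T' S' by (simp_all add: mem_cls_iff)
    have "Q_semi (op_diff (op_add T S) (op_add T' S')) = 0"
      by (rule Q_semi_add_zero[of _ "op_diff T T'" "op_diff S S'"])
        (use Z in \<open>simp_all add: Z_rel_iff L_gD op_diff_app_basis op_add_app_basis op_add_in_L_HH2\<close>)
    thus "(op_add T S, op_add T' S') \<in> Z_rel"
      using Z by (simp add: Z_rel_iff op_add_in_L_g)
  qed
  thus ?thesis
    using self_in_cls[OF assms(1)] self_in_cls[OF assms(2)] unfolding cls_add_def by blast
qed

lemma cls_scale_eq:
  assumes "T \<in> L_g"
  shows "cls_scale a (cls T) = cls (op_scale a T)"
proof -
  have "cls (op_scale a T') = cls (op_scale a T)" if T': "T' \<in> cls T" for T'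
  proof (rule cls_eqI[symmetric])
    have Z: "(T, T') \<in> Z_rel"
      using T' by (simp add: mem_cls_iff)
    have "Q_semi (op_diff (op_scale a T) (op_scale a T')) = 0"
      by (rule Q_semi_scale_zero[of _ a "op_diff T T'"])
        (use Z in \<open>simp_all add: Z_rel_iff L_gD op_diff_app_basis op_scale_app_basis op_scale_in_L_HH2
          complex_vector.scale_right_diff_distrib\<close>)
    thus "(op_scale a T, op_scale a T') \<in> Z_rel"
      using Z by (simp add: Z_rel_iff op_scale_in_L_g)
  qed
  thus ?thesis
    using self_in_cls[OF assms(1)] unfolding cls_scale_def by blast
qed

lemma Qtilde_cls:
  assumes "T \<in> L_g"
  shows "Qtilde (cls T) = real_of_ereal (Q_semi T)"
proof -
  have "Q_semi T' = Q_semi T" if "(T, T') \<in> Z_rel" for T'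
  proof (rule antisym)
    have le: "Q_semi R' \<le> Q_semi R" if "(R, R') \<in> Z_rel" "(R', R) \<in> Z_rel" for R R'
    proof -
      have "Q_semi R' \<le> Q_semi (op_diff R' R) + Q_semi R"
        using that by (intro Q_semi_le_add) (auto simp: Z_rel_iff L_gD op_diff_app_basis)
      thus ?thesis using that by (simp add: Z_rel_iff)
    qed
    show "Q_semi T' \<le> Q_semi T" "Q_semi T \<le> Q_semi T'"
      using le that equiv_Z_rel by (auto simp: equiv_def sym_def)
  qed
  hence const: "real_of_ereal (Q_semi T') = real_of_ereal (Q_semi T)" if "T' \<in> cls T" for T'
    using that by (simp add: mem_cls_iff)
  show ?thesis
    unfolding Qtilde_def
  proof (rule the_equality)
    show "\<exists>T'\<in>cls T. real_of_ereal (Q_semi T) = real_of_ereal (Q_semi T')"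
      using self_in_cls[OF assms] by blast
    show "q = real_of_ereal (Q_semi T)" if "\<exists>T'\<in>cls T. q = real_of_ereal (Q_semi T')" for q
      using that const by metis
  qed
qed

text \<open>A class in the quotient is nonempty, whereas \<open>cls T\<close> is empty for \<open>T\<close> outside \<open>L_g\<close>.\<close>

lemma cls_in_L_G_imp_L_g:
  assumes "cls T \<in> L_G"
  shows "T \<in> L_g"
proof -
  have "cls T \<noteq> {}"
    using assms in_quotient_imp_non_empty[OF equiv_Z_rel] by (auto simp: L_G_def)
  thus ?thesis by (auto simp: mem_cls_iff Z_rel_iff)
qed

lemma cls_in_G_space_approx:
  assumes "cls T \<in> G_space" "E_span \<subseteq> L_g" "e > 0"
  obtains A where "A \<in> E_span" "Q_fun (\<lambda>x. T \<cdot> x + (-1) *\<^sub>C (A \<cdot> x)) < ereal e"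
proof -
  have T: "T \<in> L_g"
    using assms cls_in_L_G_imp_L_g by (auto simp: G_space_def)
  obtain A where A: "A \<in> E_span" "Qtilde (cls_diff (cls T) (cls A)) < e"
    using assms by (auto simp: G_space_def)
  hence AL: "A \<in> L_g" using assms by auto
  define R where "R = op_add T (op_scale (-1) A)"
  have R: "R \<in> L_g"
    unfolding R_def by (intro op_add_in_L_g op_scale_in_L_g T AL)
  have "cls_diff (cls T) (cls A) = cls R"
    by (simp add: cls_diff_def cls_scale_eq cls_add_eq op_scale_in_L_g T AL R_def)
  hence "real_of_ereal (Q_semi R) < e"
    using A(2) R by (simp add: Qtilde_cls)
  \<comment> \<open>\<open>real_of_ereal\<close> maps \<open>\<infinity>\<close> to \<open>0\<close>, so the finiteness of \<open>Q_semi R\<close> matters here.\<close>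
  hence "Q_semi R < ereal e"
    using R Q_semi_nonneg[of R] by (cases "Q_semi R") (auto simp: L_g_def)
  moreover have "Q_semi R = Q_fun (\<lambda>x. T \<cdot> x + (-1) *\<^sub>C (A \<cdot> x))"
    unfolding Q_semi_eq
    by (rule Q_fun_cong) (simp add: R_def op_add_app_basis op_scale_app_basis op_scale_in_L_HH2 T AL L_gD)
  ultimately show ?thesis using that[OF A(1)] by simp
qed

section \<open>The span \<open>E\<close>\<close>

lemma norm_e_vec: "l \<in> I_rat \<Longrightarrow> norm (e_vec l k) = 1"
  by (simp add: norm_eq_sqrt_inner inner_cinner cinner_e_vec_same)

lemma basis_in_HH2: "x \<in> basis_H \<Longrightarrow> x \<in> HH2"
  by (auto simp: basis_H_def e_vec_in_HH2)

lemma norm_Tjk_basis: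
  assumes "x \<in> basis_H"
  shows "norm (Tjk j k \<cdot> x) \<le> 1"
proof -
  obtain l m where "x = e_vec l m" "l \<in> I_rat" "0 \<le> m"
    using assms by (auto simp: basis_H_def)
  thus ?thesis
    by (simp add: Tjk_e_vec norm_scaleC norm_e_vec)
qed

lemma E_spanE:
  assumes "A \<in> E_span"
  obtains F :: "(int \<times> int) set" and c where "finite F" "dom A = HH2"
    "\<And>x. x \<in> HH2 \<Longrightarrow> A \<cdot> x = (\<Sum>(j, k)\<in>F. c j k *\<^sub>C (Tjk j k \<cdot> x))"
proof -
  obtain F :: "(int \<times> int) set" and c where F: "finite F" and
    A: "A = (\<lambda>f. if f \<in> HH2 then Some (\<Sum>(j, k)\<in>F. c j k *\<^sub>C (Tjk j k \<cdot> f)) else None)"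
    using assms unfolding E_span_def by blast
  show ?thesis
  proof (rule that[OF F])
    show "dom A = HH2"
      unfolding A by (auto simp: dom_def)
    show "A \<cdot> x = (\<Sum>(j, k)\<in>F. c j k *\<^sub>C (Tjk j k \<cdot> x))" if "x \<in> HH2" for x
      unfolding A using that by simp
  qed
qed

lemma norm_E_span_bounded:
  assumes "A \<in> E_span"
  obtains K where "\<And>x. x \<in> basis_H \<Longrightarrow> norm (A \<cdot> x) \<le> K"
proof -
  obtain F c where F: "finite F" "dom A = HH2" "\<And>x. x \<in> HH2 \<Longrightarrow> A \<cdot> x = (\<Sum>(j, k)\<in>F. c j k *\<^sub>C (Tjk j k \<cdot> x))"
    by (rule E_spanE[OF assms], rule that)
  have "norm (A \<cdot> x) \<le> (\<Sum>(j, k)\<in>F. cmod (c j k))" if "x \<in> basis_H" for x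
  proof -
    have "norm (A \<cdot> x) \<le> (\<Sum>(j, k)\<in>F. norm (c j k *\<^sub>C (Tjk j k \<cdot> x)))"
      using F(3)[OF basis_in_HH2[OF that]] by (simp add: case_prod_unfold norm_sum)
    also have "\<dots> \<le> (\<Sum>(j, k)\<in>F. cmod (c j k))"
      using norm_Tjk_basis[OF that] by (intro sum_mono) (auto simp: norm_scaleC mult_left_le)
    finally show ?thesis .
  qed
  thus ?thesis by (rule that)
qed

text \<open>Without this the classes \<open>cls A\<close> in the definition of \<open>\<G>\<close> would be empty and the approximation
  in \<open>Qtilde\<close> would say nothing.\<close>

lemma E_span_subset_L_g: "E_span \<subseteq> L_g"
proof
  fix A assume A: "A \<in> E_span"
  obtain F c where F: "finite F" "dom A = HH2"
    "\<And>x. x \<in> HH2 \<Longrightarrow> A \<cdot> x = (\<Sum>(j, k)\<in>F. c j k *\<^sub>C (Tjk j k \<cdot> x))"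
    by (rule E_spanE[OF A], rule that)
  have app: "A \<cdot> x \<in> HH2" if "x \<in> HH2" for x
    using that F(3)[OF that]
    by (auto simp: Tjk_in_HH2 intro!: complex_vector.subspace_sum complex_vector.subspace_scale subspace_HH2)
  have "ran A \<subseteq> HH2"
  proof
    fix y assume "y \<in> ran A"
    then obtain x where "A x = Some y" by (auto simp: ran_def)
    thus "y \<in> HH2" using app[of x] F(2) by auto
  qed
  moreover have "A \<cdot> (x + y) = A \<cdot> x + A \<cdot> y" if "x \<in> HH2" "y \<in> HH2" for x y
    using that complex_vector.subspace_add[OF subspace_HH2 that]
    by (simp add: F(3) Tjk_add scaleC_add_right sum.distrib case_prod_unfold)
  moreover have "A \<cdot> (a *\<^sub>C x) = a *\<^sub>C (A \<cdot> x)" if "x \<in> HH2" for a x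
    using that complex_vector.subspace_scale[OF subspace_HH2 that, of a]
    by (simp add: F(3) Tjk_scaleC complex_vector.scale_sum_right scaleC_scaleC mult.commute case_prod_unfold)
  ultimately have "A \<in> L_HH2"
    using F(2) subspace_HH2 basis_in_HH2 by (auto simp: L_HH2_def)
  moreover obtain K where K: "\<And>x. x \<in> basis_H \<Longrightarrow> norm (A \<cdot> x) \<le> K"
    by (rule norm_E_span_bounded[OF A], rule that)
  have "Q_semi A < \<infinity>"
  proof -
    have "rms n (B_set n) (\<lambda>x. A \<cdot> x) \<le> \<bar>K\<bar>" for n
    proof (rule power2_le_imp_le)
      have "(\<Sum>x\<in>B_set n. (norm (A \<cdot> x))\<^sup>2) \<le> (\<Sum>x\<in>B_set n. K\<^sup>2)"
        using B_set_subset_basis[of n] by (intro sum_mono power_mono K) auto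
      also have "\<dots> \<le> real n * K\<^sup>2"
        using card_B_set_le[of n] by (simp add: mult_right_mono)
      finally show "(rms n (B_set n) (\<lambda>x. A \<cdot> x))\<^sup>2 \<le> \<bar>K\<bar>\<^sup>2"
        by (cases "n = 0") (auto simp: rms_power2 field_simps)
    qed simp
    hence "Q_semi A \<le> ereal \<bar>K\<bar>"
      unfolding Q_semi_eq by (intro Q_fun_leI[OF thin_empty]) simp
    thus ?thesis by (auto simp: less_le_trans)
  qed
  ultimately show "A \<in> L_g" by (simp add: L_g_def)
qed

section \<open>Averages over the grid\<close>

text \<open>The sesquilinear form whose quadratic form is the square of \<open>rms n (B_set n)\<close>.\<close>

definition mean_cinner :: "nat \<Rightarrow> (LL2 \<Rightarrow> LL2) \<Rightarrow> (LL2 \<Rightarrow> LL2) \<Rightarrow> complex" where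
  "mean_cinner n F G = 1 / of_nat n * (\<Sum>x\<in>B_set n. cinner (F x) (G x))"

lemma mean_cinner_cong:
  assumes "\<And>x. x \<in> basis_H \<Longrightarrow> F x = F' x" "\<And>x. x \<in> basis_H \<Longrightarrow> G x = G' x"
  shows "mean_cinner n F G = mean_cinner n F' G'"
  using B_set_subset_basis[of n] assms unfolding mean_cinner_def by (intro arg_cong2[of _ _ _ _ "(*)"] sum.cong) auto

lemma sum_B_set:
  "(\<Sum>x\<in>B_set n. f x) =
    (\<Sum>a\<in>{1..grid_size n}. \<Sum>m<grid_size n. f (e_vec (real a / real (grid_size n)) (int m)))"
proof -
  define s where "s = grid_size n"
  have "inj_on (\<lambda>(a, m). e_vec (real a / real s) (int m)) ({1..s} \<times> {..<s})"
  proof (rule inj_onI, clarify)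
    fix a m a' m' assume *: "a \<in> {1..s}" "a' \<in> {1..s}" "e_vec (real a / real s) (int m) = e_vec (real a' / real s) (int m')"
    hence "real a / real s = real a' / real s \<and> int m = int m'"
      by (intro e_vec_inject fraction_in_I_rat) auto
    thus "a = a' \<and> m = m'" using * by auto
  qed
  thus ?thesis
    unfolding B_set_eq_image s_def[symmetric]
    by (simp add: sum.reindex sum.cartesian_product case_prod_unfold)
qed

text \<open>A geometric sum with ratio a nontrivial \<open>s\<close>-th root of unity; the bound on \<open>q\<close> makes it
  nontrivial.\<close>

lemma sum_exp_eq_0:
  fixes q :: int and s :: nat
  assumes "q \<noteq> 0" "\<bar>q\<bar> < int s"
  shows "(\<Sum>a\<in>{1..s}. exp (2 * pi * \<i> * of_int q * of_real (real a / real s))) = 0"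
proof -
  define w where "w = exp (2 * pi * \<i> * of_int q / of_nat s)"
  have s: "s > 0" using assms by auto
  have pow: "exp (2 * pi * \<i> * of_int q * of_real (real a / real s)) = w ^ a" for a
    by (simp add: w_def exp_of_nat_mult[symmetric] algebra_simps)
  have "w ^ s = exp (2 * of_int q * pi * \<i>)"
    using s by (simp add: w_def exp_of_nat_mult[symmetric] algebra_simps)
  hence 1: "w ^ s = 1"
    using exp_integer_2pi[of "of_int q"] by simp
  have "w \<noteq> 1"
  proof
    assume "w = 1"
    then obtain k :: int where "Im (2 * pi * \<i> * of_int q / of_nat s) = of_int (2 * k) * pi"
      by (auto simp: w_def exp_eq_1)
    hence "of_int q = real_of_int (k * int s)"
      using s by (simp add: field_simps)
    hence "q = k * int s" by (simp only: of_int_eq_iff)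
    moreover have "k \<noteq> 0" using assms calculation by auto
    hence "1 * int s \<le> \<bar>k\<bar> * int s" by (intro mult_right_mono) auto
    ultimately have "int s \<le> \<bar>q\<bar>" by (simp add: abs_mult)
    thus False using assms by simp
  qed
  have "(\<Sum>a\<in>{1..s}. w ^ a) = (\<Sum>a<s. w * w ^ a)"
    by (simp add: sum.atLeast1_atMost_eq)
  also have "\<dots> = w * ((w ^ s - 1) / (w - 1))"
    using \<open>w \<noteq> 1\<close> by (simp add: sum_distrib_left[symmetric] geometric_sum)
  finally show ?thesis
    unfolding pow by (simp add: 1)
qed

lemma cinner_Tjk_e_vec:
  assumes "l \<in> I_rat" "0 \<le> m"
  shows "cinner (Tjk j k \<cdot> e_vec l m) (Tjk j' k' \<cdot> e_vec l m) =
    (if k = k' \<and> 0 \<le> k + m then exp (2 * pi * \<i> * of_int (j - j') * of_real l) else 0)"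
proof -
  have "cnj (exp (2 * pi * \<i> * of_int j' * of_real l)) * exp (2 * pi * \<i> * of_int j * of_real l) =
      exp (2 * pi * \<i> * of_int (j - j') * of_real l)"
    by (simp add: exp_cnj exp_add[symmetric] algebra_simps)
  thus ?thesis
    using assms by (simp add: Tjk_e_vec cinner_scaleC_left cinner_scaleC_right cinner_e_vec_same)
qed

text \<open>The offset \<open>r\<close> accounts for the basis vectors with \<open>m < r = -k\<close>, which \<open>T\<^sub>j\<^sub>k\<close> annihilates.\<close>

lemma grid_size_asymp: "(\<lambda>n. real (grid_size n - r) / sqrt (real n)) \<longlonglongrightarrow> 1"
proof (rule tendsto_sandwich)
  show "(\<lambda>n. (sqrt (real n) - 1 - real r) / sqrt (real n)) \<longlonglongrightarrow> 1" by real_asymp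
  show "(\<lambda>n. 1::real) \<longlonglongrightarrow> 1" by simp
  have "sqrt (real n) - 1 - real r \<le> real (grid_size n - r)" for n
  proof -
    have "real (grid_size n) = of_int \<lfloor>sqrt (real n)\<rfloor>" by (simp add: grid_size_def)
    thus ?thesis by linarith
  qed
  thus "\<forall>\<^sub>F n in sequentially. (sqrt (real n) - 1 - real r) / sqrt (real n) \<le> real (grid_size n - r) / sqrt (real n)"
    by (simp add: divide_right_mono)
  have "real (grid_size n - r) / sqrt (real n) \<le> sqrt (real n) / sqrt (real n)" for n
    using grid_size_le_sqrt[of n] by (intro divide_right_mono) linarith+
  moreover have "sqrt (real n) / sqrt (real n) \<le> 1" for n
    by simp
  ultimately show "\<forall>\<^sub>F n in sequentially. real (grid_size n - r) / sqrt (real n) \<le> 1"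
    by (intro always_eventually allI) (rule order_trans)
qed

text \<open>Orthonormality of the generators in the limit. The sum over the grid factors into an
  exponential sum over \<open>l\<close> and the number of \<open>m\<close> with \<open>m + k \<ge> 0\<close>.\<close>

lemma tendsto_mean_cinner_Tjk:
  "(\<lambda>n. mean_cinner n (\<lambda>x. Tjk j k \<cdot> x) (\<lambda>x. Tjk j' k' \<cdot> x)) \<longlonglongrightarrow> (if j = j' \<and> k = k' then 1 else 0)"
proof -
  define r where "r = nat (- k)"
  define E where "E = (\<lambda>n. \<Sum>a\<in>{1..grid_size n}. exp (2 * pi * \<i> * of_int (j - j') * of_real (real a / real (grid_size n))))"
  have mean: "mean_cinner n (\<lambda>x. Tjk j k \<cdot> x) (\<lambda>x. Tjk j' k' \<cdot> x) =
      (if k = k' then of_nat (grid_size n - r) * E n / of_nat n else 0)" for n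
  proof -
    have inner: "(\<Sum>m<grid_size n. cinner (Tjk j k \<cdot> e_vec (real a / real (grid_size n)) (int m)) (Tjk j' k' \<cdot> e_vec (real a / real (grid_size n)) (int m))) =
        (if k = k' then of_nat (grid_size n - r) * exp (2 * pi * \<i> * of_int (j - j') * of_real (real a / real (grid_size n))) else 0)"
      if a: "a \<in> {1..grid_size n}" for a
    proof -
      let ?w = "exp (2 * pi * \<i> * of_int (j - j') * of_real (real a / real (grid_size n)))"
      have "(\<Sum>m<grid_size n. cinner (Tjk j k \<cdot> e_vec (real a / real (grid_size n)) (int m)) (Tjk j' k' \<cdot> e_vec (real a / real (grid_size n)) (int m))) =
          (\<Sum>m<grid_size n. if k = k' \<and> 0 \<le> k + int m then ?w else 0)"
        by (intro sum.cong refl cinner_Tjk_e_vec fraction_in_I_rat) (use a in auto)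
      also have "\<dots> = (if k = k' then \<Sum>m | m < grid_size n \<and> 0 \<le> k + int m. ?w else 0)"
        by (simp add: sum.inter_filter[symmetric] del: sum_constant)
      also have "{m. m < grid_size n \<and> 0 \<le> k + int m} = {r..<grid_size n}"
        by (auto simp: r_def)
      finally show ?thesis by simp
    qed
    have "(\<Sum>x\<in>B_set n. cinner (Tjk j k \<cdot> x) (Tjk j' k' \<cdot> x)) = (\<Sum>a\<in>{1..grid_size n}.
        if k = k' then of_nat (grid_size n - r) *
          exp (2 * pi * \<i> * of_int (j - j') * of_real (real a / real (grid_size n))) else 0)"
      unfolding sum_B_set by (rule sum.cong[OF refl inner])
    also have "\<dots> = (if k = k' then of_nat (grid_size n - r) * E n else 0)"
      by (simp add: E_def sum_distrib_left)
    finally show ?thesis by (simp add: mean_cinner_def)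
  qed
  consider "k \<noteq> k'" | "k = k'" "j \<noteq> j'" | "k = k'" "j = j'" by blast
  thus ?thesis
  proof cases
    case 1
    thus ?thesis by (simp add: mean)
  next
    case 2
    have "filterlim (\<lambda>n. real (grid_size n)) at_top sequentially"
      unfolding grid_size_def by real_asymp
    hence "\<forall>\<^sub>F n in sequentially. real_of_int \<bar>j - j'\<bar> < real (grid_size n)"
      unfolding filterlim_at_top_dense by blast
    hence "\<forall>\<^sub>F n in sequentially. mean_cinner n (\<lambda>x. Tjk j k \<cdot> x) (\<lambda>x. Tjk j' k' \<cdot> x) = 0"
    proof eventually_elim
      case (elim n)
      hence "\<bar>j - j'\<bar> < int (grid_size n)" by linarith
      hence "E n = 0"
        unfolding E_def using 2 by (intro sum_exp_eq_0) auto
      thus ?case by (simp add: mean)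
    qed
    thus ?thesis using 2 by (simp add: tendsto_eventually)
  next
    case 3
    have "(\<lambda>n. real (grid_size n - r) / sqrt (real n) * (real (grid_size n - 0) / sqrt (real n))) \<longlonglongrightarrow> 1 * 1"
      by (intro tendsto_mult grid_size_asymp)
    hence "(\<lambda>n. complex_of_real (real (grid_size n - r) / sqrt (real n) * (real (grid_size n - 0) / sqrt (real n)))) \<longlonglongrightarrow> of_real (1 * 1)"
      by (rule tendsto_of_real)
    moreover have "complex_of_real (real (grid_size n - r) / sqrt (real n) * (real (grid_size n - 0) / sqrt (real n))) =
       mean_cinner n (\<lambda>x. Tjk j k \<cdot> x) (\<lambda>x. Tjk j' k' \<cdot> x)" for n
    proof -
      have "real (grid_size n - r) / sqrt (real n) * (real (grid_size n - 0) / sqrt (real n)) = real (grid_size n - r) * real (grid_size n) / real n"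
        by simp
      moreover have "E n = of_nat (grid_size n)" using 3 by (simp add: E_def)
      ultimately show ?thesis using mean[of n] 3 by simp
    qed
    ultimately show ?thesis using 3 by simp
  qed
qed

lemma mean_cinner_add_left: "mean_cinner n (\<lambda>x. F x + F' x) G = mean_cinner n F G + mean_cinner n F' G"
  by (simp add: mean_cinner_def cinner_add_left sum.distrib add_divide_distrib)

lemma mean_cinner_add_right: "mean_cinner n G (\<lambda>x. F x + F' x) = mean_cinner n G F + mean_cinner n G F'"
  by (simp add: mean_cinner_def cinner_add_right sum.distrib add_divide_distrib)

lemma mean_cinner_scaleC_left: "mean_cinner n (\<lambda>x. a *\<^sub>C F x) G = a * mean_cinner n F G"
  by (simp add: mean_cinner_def cinner_scaleC_left sum_distrib_left)

lemma mean_cinner_scaleC_right: "mean_cinner n G (\<lambda>x. a *\<^sub>C F x) = cnj a * mean_cinner n G F"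
  by (simp add: mean_cinner_def cinner_scaleC_right sum_distrib_left)

lemma mean_cinner_sum_left:
  "mean_cinner n (\<lambda>x. \<Sum>i\<in>I. F i x) G = (\<Sum>i\<in>I. mean_cinner n (F i) G)"
  unfolding mean_cinner_def cinner_sum_left by (subst sum.swap) (simp add: sum_distrib_left)

lemma mean_cinner_sum_right:
  "mean_cinner n G (\<lambda>x. \<Sum>i\<in>I. F i x) = (\<Sum>i\<in>I. mean_cinner n G (F i))"
  unfolding mean_cinner_def cinner_sum_right by (subst sum.swap) (simp add: sum_distrib_left)

lemma rms_power2_eq_mean_cinner: "complex_of_real ((rms n (B_set n) F)\<^sup>2) = mean_cinner n F F"
  by (simp add: rms_power2 mean_cinner_def cinner_self)

lemma convergent_mean_cinner_E_span:
  assumes "A \<in> E_span" "A' \<in> E_span"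
  shows "convergent (\<lambda>n. mean_cinner n (\<lambda>x. A \<cdot> x) (\<lambda>x. A' \<cdot> x))"
proof -
  obtain F c where "finite F" "dom A = HH2" and A: "\<And>x. x \<in> HH2 \<Longrightarrow> A \<cdot> x = (\<Sum>(j, k)\<in>F. c j k *\<^sub>C (Tjk j k \<cdot> x))"
    by (rule E_spanE[OF assms(1)], rule that)
  obtain F' c' where "finite F'" "dom A' = HH2" and A': "\<And>x. x \<in> HH2 \<Longrightarrow> A' \<cdot> x = (\<Sum>(j, k)\<in>F'. c' j k *\<^sub>C (Tjk j k \<cdot> x))"
    by (rule E_spanE[OF assms(2)], rule that)
  have "mean_cinner n (\<lambda>x. A \<cdot> x) (\<lambda>x. A' \<cdot> x) = (\<Sum>(j, k)\<in>F. \<Sum>(j', k')\<in>F'.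
      c j k * (cnj (c' j' k') * mean_cinner n (\<lambda>x. Tjk j k \<cdot> x) (\<lambda>x. Tjk j' k' \<cdot> x)))" for n
  proof -
    have "mean_cinner n (\<lambda>x. A \<cdot> x) (\<lambda>x. A' \<cdot> x) = mean_cinner n
        (\<lambda>x. \<Sum>(j, k)\<in>F. c j k *\<^sub>C (Tjk j k \<cdot> x)) (\<lambda>x. \<Sum>(j, k)\<in>F'. c' j k *\<^sub>C (Tjk j k \<cdot> x))"
      by (rule mean_cinner_cong) (simp_all add: A A' basis_in_HH2)
    thus ?thesis
      by (simp add: case_prod_unfold mean_cinner_sum_left mean_cinner_sum_right
          mean_cinner_scaleC_left mean_cinner_scaleC_right sum_distrib_left)
  qed
  moreover have "(\<lambda>n. \<Sum>(j, k)\<in>F. \<Sum>(j', k')\<in>F'.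
      c j k * (cnj (c' j' k') * mean_cinner n (\<lambda>x. Tjk j k \<cdot> x) (\<lambda>x. Tjk j' k' \<cdot> x)))
    \<longlonglongrightarrow> (\<Sum>(j, k)\<in>F. \<Sum>(j', k')\<in>F'. c j k * (cnj (c' j' k') * (if j = j' \<and> k = k' then 1 else 0)))"
    unfolding case_prod_unfold
    by (intro tendsto_sum tendsto_mult tendsto_const tendsto_mean_cinner_Tjk)
  ultimately show ?thesis by (auto simp: convergent_def)
qed

lemma convergent_rms_E_span:
  assumes "A \<in> E_span" "A' \<in> E_span"
  shows "convergent (\<lambda>n. rms n (B_set n) (\<lambda>x. A \<cdot> x + a *\<^sub>C (A' \<cdot> x)))"
proof -
  have "(\<lambda>n. mean_cinner n (\<lambda>x. A \<cdot> x + a *\<^sub>C (A' \<cdot> x)) (\<lambda>x. A \<cdot> x + a *\<^sub>C (A' \<cdot> x))) =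
    (\<lambda>n. mean_cinner n (\<lambda>x. A \<cdot> x) (\<lambda>x. A \<cdot> x) + cnj a * mean_cinner n (\<lambda>x. A \<cdot> x) (\<lambda>x. A' \<cdot> x) +
      (a * mean_cinner n (\<lambda>x. A' \<cdot> x) (\<lambda>x. A \<cdot> x) + a * (cnj a * mean_cinner n (\<lambda>x. A' \<cdot> x) (\<lambda>x. A' \<cdot> x))))"
    by (simp add: mean_cinner_add_left mean_cinner_add_right mean_cinner_scaleC_left mean_cinner_scaleC_right)
  moreover have "convergent \<dots>"
    by (intro convergent_add convergent_mult convergent_const convergent_mean_cinner_E_span assms)
  ultimately obtain z where z: "(\<lambda>n. mean_cinner n (\<lambda>x. A \<cdot> x + a *\<^sub>C (A' \<cdot> x)) (\<lambda>x. A \<cdot> x + a *\<^sub>C (A' \<cdot> x))) \<longlonglongrightarrow> z"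
    by (auto simp: convergent_def)
  have "(\<lambda>n. (rms n (B_set n) (\<lambda>x. A \<cdot> x + a *\<^sub>C (A' \<cdot> x)))\<^sup>2) \<longlonglongrightarrow> Re z"
    using tendsto_Re[OF z] by (simp add: rms_power2_eq_mean_cinner[symmetric] del: of_real_power)
  from tendsto_real_sqrt[OF this] show ?thesis
    by (auto simp: convergent_def)
qed

section \<open>The inner product of \<open>\<G>\<close>\<close>

text \<open>If \<open>A\<close> approximates \<open>T\<close> and \<open>A'\<close> approximates \<open>S\<close>, then \<open>A + a A'\<close> approximates \<open>T + a S\<close>.
  For the polarization identity \<open>a\<close> is a power of \<open>\<i>\<close>.\<close>

lemma rms_combination_tendsto_Q_fun:
  assumes T: "cls T \<in> G_space" "negligible_on_thin (\<lambda>x. T \<cdot> x)"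
    and S: "cls S \<in> G_space" "negligible_on_thin (\<lambda>x. S \<cdot> x)"
    and a: "cmod a = 1"
  shows "(\<lambda>n. rms n (B_set n) (\<lambda>x. T \<cdot> x + a *\<^sub>C (S \<cdot> x))) \<longlonglongrightarrow>
    real_of_ereal (Q_fun (\<lambda>x. T \<cdot> x + a *\<^sub>C (S \<cdot> x)))"
proof (rule rms_tendsto_Q_fun_if_approximable)
  show "negligible_on_thin (\<lambda>x. T \<cdot> x + a *\<^sub>C (S \<cdot> x))"
    by (intro negligible_on_thin_add negligible_on_thin_scaleC T S)
  fix e :: real assume e: "e > 0"
  obtain A where A: "A \<in> E_span" "Q_fun (\<lambda>x. T \<cdot> x + (-1) *\<^sub>C (A \<cdot> x)) < ereal (e / 2)"
    using cls_in_G_space_approx[OF T(1) E_span_subset_L_g, of "e / 2"] e by auto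
  obtain A' where A': "A' \<in> E_span" "Q_fun (\<lambda>x. S \<cdot> x + (-1) *\<^sub>C (A' \<cdot> x)) < ereal (e / 2)"
    using cls_in_G_space_approx[OF S(1) E_span_subset_L_g, of "e / 2"] e by auto
  define G where "G = (\<lambda>x. A \<cdot> x + a *\<^sub>C (A' \<cdot> x))"
  have neg: "negligible_on_thin (\<lambda>x. A \<cdot> x)" if "A \<in> E_span" for A
    using that by (elim norm_E_span_bounded) (rule negligible_on_thin_bounded)
  have "negligible_on_thin G"
    unfolding G_def by (intro negligible_on_thin_add negligible_on_thin_scaleC neg A A')
  moreover have "convergent (\<lambda>n. rms n (B_set n) G)"
    unfolding G_def by (intro convergent_rms_E_span A A')
  moreover have "Q_fun (\<lambda>x. (T \<cdot> x + a *\<^sub>C (S \<cdot> x)) + (-1) *\<^sub>C G x) < ereal e"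
  proof -
    let ?F = "\<lambda>x. T \<cdot> x + (-1) *\<^sub>C (A \<cdot> x)" and ?F' = "\<lambda>x. S \<cdot> x + (-1) *\<^sub>C (A' \<cdot> x)"
    have fin: "Q_fun ?F' < \<infinity>"
      using A'(2) by (rule less_trans) simp
    have "(\<lambda>x. (T \<cdot> x + a *\<^sub>C (S \<cdot> x)) + (-1) *\<^sub>C G x) = (\<lambda>x. ?F x + a *\<^sub>C ?F' x)"
      by (simp add: G_def fun_eq_iff scaleC_add_right complex_vector.scale_right_diff_distrib
          complex_vector.scale_minus_left)
    hence "Q_fun (\<lambda>x. (T \<cdot> x + a *\<^sub>C (S \<cdot> x)) + (-1) *\<^sub>C G x) \<le> Q_fun ?F + Q_fun (\<lambda>x. a *\<^sub>C ?F' x)"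
      using Q_fun_add[of ?F "\<lambda>x. a *\<^sub>C ?F' x"] by simp
    also have "\<dots> \<le> Q_fun ?F + Q_fun ?F'"
      using Q_fun_scaleC[OF fin, of a] by (intro add_left_mono) (simp add: a one_ereal_def[symmetric])
    also have "\<dots> < ereal (e / 2) + ereal (e / 2)"
      using A(2) A'(2) by (rule ereal_add_strict_mono2)
    finally show ?thesis by simp
  qed
  ultimately show "\<exists>G. negligible_on_thin G \<and> convergent (\<lambda>n. rms n (B_set n) G) \<and>
      Q_fun (\<lambda>x. (T \<cdot> x + a *\<^sub>C (S \<cdot> x)) + (-1) *\<^sub>C G x) < ereal e"
    by blast
qed

lemma mean_cinner_polarization:
  "mean_cinner n F G = 1 / 4 * (\<Sum>m<4. \<i> ^ m * of_real ((rms n (B_set n) (\<lambda>x. F x + \<i> ^ m *\<^sub>C G x))\<^sup>2))"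
proof -
  have "mean_cinner n F G = 1 / of_nat n * (\<Sum>x\<in>B_set n. 1 / 4 * (\<Sum>m<4. \<i> ^ m * of_real ((norm (F x + \<i> ^ m *\<^sub>C G x))\<^sup>2)))"
    unfolding mean_cinner_def by (simp only: cinner_polarization[symmetric])
  also have "\<dots> = 1 / 4 * (\<Sum>m<4. \<i> ^ m * (1 / of_nat n * (\<Sum>x\<in>B_set n. of_real ((norm (F x + \<i> ^ m *\<^sub>C G x))\<^sup>2))))"
    by (subst sum_distrib_left[symmetric], subst sum.swap) (simp add: sum_distrib_left mult_ac)
  finally show ?thesis by (simp add: rms_power2)
qed

lemma inner_G_cls:
  assumes "T \<in> L_g" "S \<in> L_g"
  shows "inner_G (cls T) (cls S) =
    1 / 4 * (\<Sum>m<4. \<i> ^ m * of_real ((real_of_ereal (Q_fun (\<lambda>x. T \<cdot> x + \<i> ^ m *\<^sub>C (S \<cdot> x))))\<^sup>2))"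
proof -
  have "Qtilde (cls_add (cls T) (cls_scale (\<i> ^ m) (cls S))) =
      real_of_ereal (Q_fun (\<lambda>x. T \<cdot> x + \<i> ^ m *\<^sub>C (S \<cdot> x)))" for m
  proof -
    have "Q_semi (op_add T (op_scale (\<i> ^ m) S)) = Q_fun (\<lambda>x. T \<cdot> x + \<i> ^ m *\<^sub>C (S \<cdot> x))"
      unfolding Q_semi_eq
      by (rule Q_fun_cong) (simp add: op_add_app_basis op_scale_app_basis op_scale_in_L_HH2 assms L_gD)
    thus ?thesis
      by (simp add: cls_scale_eq cls_add_eq Qtilde_cls op_add_in_L_g op_scale_in_L_g assms)
  qed
  thus ?thesis by (simp add: inner_G_def)
qed

theorem theorem4p16:
  fixes T S :: op
  assumes "T \<in> L_HH2" and "S \<in> L_HH2"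
    and "cls T \<in> G_space" and "cls S \<in> G_space"
    and "\<And>D. (\<forall>n. D n \<subseteq> B_set n) \<Longrightarrow> (\<lambda>n. real (card (D n))) \<in> o(\<lambda>n. real n) \<Longrightarrow>
           (\<lambda>n. 1 / real n * (\<Sum>x\<in>D n. (norm (T \<cdot> x))\<^sup>2)) \<longlonglongrightarrow> 0 \<and>
           (\<lambda>n. 1 / real n * (\<Sum>x\<in>D n. (norm (S \<cdot> x))\<^sup>2)) \<longlonglongrightarrow> 0"
  shows "(\<lambda>n. 1 / of_nat n * (\<Sum>x\<in>B_set n. cinner (T \<cdot> x) (S \<cdot> x))) \<longlonglongrightarrow> inner_G (cls T) (cls S)"
proof -
  have L_g: "T \<in> L_g" "S \<in> L_g"
    using assms(3,4) cls_in_L_G_imp_L_g by (auto simp: G_space_def)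
  have neg: "negligible_on_thin (\<lambda>x. T \<cdot> x)" "negligible_on_thin (\<lambda>x. S \<cdot> x)"
    using assms(5) by (auto simp: negligible_on_thin_iff thin_iff_smallo)
  have "(\<lambda>n. 1 / 4 * (\<Sum>m<4. \<i> ^ m * of_real ((rms n (B_set n) (\<lambda>x. T \<cdot> x + \<i> ^ m *\<^sub>C (S \<cdot> x)))\<^sup>2))) \<longlonglongrightarrow>
      1 / 4 * (\<Sum>m<4. \<i> ^ m * of_real ((real_of_ereal (Q_fun (\<lambda>x. T \<cdot> x + \<i> ^ m *\<^sub>C (S \<cdot> x))))\<^sup>2))"
    by (intro tendsto_mult tendsto_const tendsto_sum tendsto_of_real tendsto_power
        rms_combination_tendsto_Q_fun assms neg) (simp add: norm_power)
  thus ?thesis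
    unfolding mean_cinner_polarization[symmetric] inner_G_cls[OF L_g] mean_cinner_def .
qed

end
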